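(* Let $S$ be a monoid with finitely many left ideals and finitely many right ideals. If $S$ has finite derivation type then every Schützenberger group of $S$ (i.e. the Schützenberger group of every $\mathscr{H}$-class of $S$) has finite derivation type.
   Context: Green's relations on a monoid $S$: $x\mathscr{R}y$ iff $xS=yS$; $x\mathscr{L}y$ iff $Sx=Sy$; $\mathscr{H}=\mathscr{R}\cap\mathscr{L}$. The (right) Schützenberger group of an $\mathscr{H}$-class $H$ is $\mathrm{Stab}(H)/\sigma$, where $\mathrm{Stab}(H)=\{s\in S: Hs=H\}$ and $(s,t)\in\sigma$ iff $xs=xt$ for all $x\in H$; it is a group. A monoid presentation $\mathcal{P}=\langle A\mid\mathfrak{R}\rangle$ consists of a set $A$ and $\mathfrak{R}\subseteq A^*\times A^*$; it defines the quotient of the free monoid $A^*$ by the congruence generated by $\mathfrak{R}$, and is finite if $A,\mathfrak R$ are finite. The derivation graph $\Gamma(\mathcal{P})$ has vertex set $A^*$ and edges $\mathbb{E}=(\alpha,r,\epsilon,\beta)$ with $\alpha,\beta\in A^*$, $r=(r_{+1},r_{-1})\in\mathfrak{R}$, $\epsilon=\pm1$, where $\iota\mathbb{E}=\alpha r_\epsilon\beta$, $\tau\mathbb{E}=\alpha r_{-\epsilon}\beta$, $\mathbb{E}^{-1}=(\alpha,r,-\epsilon,\beta)$. Paths are composed with $\circ$ (empty paths allowed). $A^*$ acts on both sides: $\gamma\cdot\mathbb{E}\cdot\delta=(\gamma\alpha,r,\epsilon,\beta\delta)$, extended to paths. The Squier complex $\mathcal{D}(\mathcal{P})$ is the 2-complex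 with 1-skeleton $\Gamma(\mathcal{P})$ and defining closed paths $[\mathbb{E}_1,\mathbb{E}_2]=(\mathbb{E}_1\cdot\iota\mathbb{E}_2)\circ(\tau\mathbb{E}_1\cdot\mathbb{E}_2)\circ(\mathbb{E}_1^{-1}\cdot\tau\mathbb{E}_2)\circ(\iota\mathbb{E}_1\cdot\mathbb{E}_2^{-1})$ for all edges $\mathbb{E}_1,\mathbb{E}_2$. In a 2-complex, two paths are homotopic if one is obtained from the other by finitely many moves: insert/delete a subpath $e\circ e^{-1}$; replace a subpath $p$ by $q$ if $p\circ q^{-1}$ is a cyclic permutation of a defining path or the inverse of one. A set $X$ of closed paths in $\mathcal{D}(\mathcal{P})$ is a homotopy base if, after adjoining all $\alpha\cdot\mathbb{P}\cdot\beta$ ($\alpha,\beta\in A^*$, $\mathbb{P}\in X$) as further defining paths, every closed path is homotopic to an empty path. A presentation has finite derivation type (FDT) if its Squier complex has a finite homotopy base; a monoid has FDT if it is defined by a finite presentation having FDT (for finite presentations this is independent of the choice of presentation). A group has FDT when it does so as a monoid. *)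

theory Defs
  imports "HOL-Algebra.Coset" "Graph_Theory.Arc_Walk"
begin

section \<open>Monoids, congruences and Green's relations\<close>

definition left_ideal :: "('a, 'm) monoid_scheme \<Rightarrow> 'a set \<Rightarrow> bool" where
  "left_ideal S I \<longleftrightarrow> I \<noteq> {} \<and> I \<subseteq> carrier S \<and> (\<forall>s\<in>carrier S. \<forall>x\<in>I. s \<otimes>\<^bsub>S\<^esub> x \<in> I)"

definition right_ideal :: "('a, 'm) monoid_scheme \<Rightarrow> 'a set \<Rightarrow> bool" where
  "right_ideal S I \<longleftrightarrow> I \<noteq> {} \<and> I \<subseteq> carrier S \<and> (\<forall>s\<in>carrier S. \<forall>x\<in>I. x \<otimes>\<^bsub>S\<^esub> s \<in> I)"

text \<open>The quotient by a congruence. The product of two classes is written as the union of the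
  classes of all products of representatives; for a congruence these all coincide.\<close>

definition quot_monoid :: "('a, 'm) monoid_scheme \<Rightarrow> ('a \<times> 'a) set \<Rightarrow> 'a set monoid" where
  "quot_monoid M r =
    \<lparr>carrier = carrier M // r,
     mult = (\<lambda>X Y. \<Union>x\<in>X. \<Union>y\<in>Y. r `` {x \<otimes>\<^bsub>M\<^esub> y}),
     one = r `` {\<one>\<^bsub>M\<^esub>}\<rparr>"

inductive_set cong_gen :: "('a, 'm) monoid_scheme \<Rightarrow> ('a \<times> 'a) set \<Rightarrow> ('a \<times> 'a) set"
  for M (structure) and R where
  base: "(x, y) \<in> R \<Longrightarrow> x \<in> carrier M \<Longrightarrow> y \<in> carrier M \<Longrightarrow> (x, y) \<in> cong_gen M R"
| refl: "x \<in> carrier M \<Longrightarrow> (x, x) \<in> cong_gen M R"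
| sym: "(x, y) \<in> cong_gen M R \<Longrightarrow> (y, x) \<in> cong_gen M R"
| trans: "(x, y) \<in> cong_gen M R \<Longrightarrow> (y, z) \<in> cong_gen M R \<Longrightarrow> (x, z) \<in> cong_gen M R"
| mult: "(x, y) \<in> cong_gen M R \<Longrightarrow> (x', y') \<in> cong_gen M R \<Longrightarrow>
    (x \<otimes> x', y \<otimes> y') \<in> cong_gen M R"

definition green_R :: "('a, 'm) monoid_scheme \<Rightarrow> ('a \<times> 'a) set" where
  "green_R S = {(x, y). x \<in> carrier S \<and> y \<in> carrier S \<and>
    x <#\<^bsub>S\<^esub> carrier S = y <#\<^bsub>S\<^esub> carrier S}"

definition green_L :: "('a, 'm) monoid_scheme \<Rightarrow> ('a \<times> 'a) set" where
  "green_L S = {(x, y). x \<in> carrier S \<and> y \<in> carrier S \<and>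
    carrier S #>\<^bsub>S\<^esub> x = carrier S #>\<^bsub>S\<^esub> y}"

definition green_H :: "('a, 'm) monoid_scheme \<Rightarrow> ('a \<times> 'a) set" where
  "green_H S = green_R S \<inter> green_L S"

definition right_stab :: "('a, 'm) monoid_scheme \<Rightarrow> 'a set \<Rightarrow> 'a set" where
  "right_stab S H = {s \<in> carrier S. H #>\<^bsub>S\<^esub> s = H}"

definition schutz_cong :: "('a, 'm) monoid_scheme \<Rightarrow> 'a set \<Rightarrow> ('a \<times> 'a) set" where
  "schutz_cong S H = {(s, t). s \<in> right_stab S H \<and> t \<in> right_stab S H \<and>
    (\<forall>x\<in>H. x \<otimes>\<^bsub>S\<^esub> s = x \<otimes>\<^bsub>S\<^esub> t)}"

definition schutz_group :: "('a, 'm) monoid_scheme \<Rightarrow> 'a set \<Rightarrow> 'a set monoid" where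
  "schutz_group S H = quot_monoid (S\<lparr>carrier := right_stab S H\<rparr>) (schutz_cong S H)"

section \<open>Homotopy in 2-complexes\<close>

text \<open>The underlying graph is a directed graph whose arcs come with formal inverses. A path is
  a pair of its initial vertex and its list of arcs, so that there is one empty path at each
  vertex.\<close>

type_synonym ('v, 'e) path = "'v \<times> 'e list"

record ('v, 'e) two_complex =
  skeleton :: "('v, 'e) pre_digraph"
  arc_inv :: "'e \<Rightarrow> 'e"
  defining :: "('v, 'e) path set"

definition path_betw :: "('v, 'e) two_complex \<Rightarrow> 'v \<Rightarrow> 'e list \<Rightarrow> 'v \<Rightarrow> bool" where
  "path_betw K u p v \<longleftrightarrow> pre_digraph.awalk (skeleton K) u p v"

definition closed_paths :: "('v, 'e) two_complex \<Rightarrow> ('v, 'e) path set" where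
  "closed_paths K = {(v, p). path_betw K v p v}"

definition inv_arcs :: "('v, 'e) two_complex \<Rightarrow> 'e list \<Rightarrow> 'e list" where
  "inv_arcs K p = rev (map (arc_inv K) p)"

definition cyclic_perms :: "('v, 'e) two_complex \<Rightarrow> ('v, 'e) path set \<Rightarrow> ('v, 'e) path set" where
  "cyclic_perms K D = {(w, q @ p) | v w p q. (v, p @ q) \<in> D \<and> path_betw K v p w}"

definition relators :: "('v, 'e) two_complex \<Rightarrow> ('v, 'e) path set" where
  "relators K = cyclic_perms K (defining K \<union> {(v, inv_arcs K p) | v p. (v, p) \<in> defining K})"

inductive homotopy_move :: "('v, 'e) two_complex \<Rightarrow> ('v, 'e) path \<Rightarrow> ('v, 'e) path \<Rightarrow> bool"
  for K where
  insert: "path_betw K u p v \<Longrightarrow> path_betw K v [e, arc_inv K e] v \<Longrightarrow> path_betw K v q w \<Longrightarrow>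
    homotopy_move K (u, p @ q) (u, p @ [e, arc_inv K e] @ q)"
| delete: "path_betw K u p v \<Longrightarrow> path_betw K v [e, arc_inv K e] v \<Longrightarrow> path_betw K v q w \<Longrightarrow>
    homotopy_move K (u, p @ [e, arc_inv K e] @ q) (u, p @ q)"
| replace: "path_betw K u p v \<Longrightarrow> path_betw K v a v' \<Longrightarrow> path_betw K v b v' \<Longrightarrow>
    path_betw K v' q w \<Longrightarrow> (v, a @ inv_arcs K b) \<in> relators K \<Longrightarrow>
    homotopy_move K (u, p @ a @ q) (u, p @ b @ q)"

definition homotopic :: "('v, 'e) two_complex \<Rightarrow> ('v, 'e) path \<Rightarrow> ('v, 'e) path \<Rightarrow> bool" where
  "homotopic K = (homotopy_move K)\<^sup>*\<^sup>*"

section \<open>Presentations and the Squier complex\<close>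

record 'a presentation =
  gens :: "'a set"
  rels :: "('a list \<times> 'a list) set"

definition is_presentation :: "'a presentation \<Rightarrow> bool" where
  "is_presentation P \<longleftrightarrow> rels P \<subseteq> lists (gens P) \<times> lists (gens P)"

definition finite_presentation :: "'a presentation \<Rightarrow> bool" where
  "finite_presentation P \<longleftrightarrow> is_presentation P \<and> finite (gens P) \<and> finite (rels P)"

definition free_monoid :: "'a set \<Rightarrow> 'a list monoid" where
  "free_monoid A = \<lparr>carrier = lists A, mult = (@), one = []\<rparr>"

definition presented_monoid :: "'a presentation \<Rightarrow> 'a list set monoid" where
  "presented_monoid P =
    quot_monoid (free_monoid (gens P)) (cong_gen (free_monoid (gens P)) (rels P))"

text \<open>In an edge \<open>Edge \<alpha> r \<epsilon> \<beta>\<close> the sign \<open>\<epsilon> = \<plusminus>1\<close> is a Boolean, with \<open>True\<close> for \<open>+1\<close>.\<close>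

datatype 'a edge = Edge "'a list" "'a list \<times> 'a list" bool "'a list"

fun side :: "'a list \<times> 'a list \<Rightarrow> bool \<Rightarrow> 'a list" where
  "side r True = fst r"
| "side r False = snd r"

fun edge_source :: "'a edge \<Rightarrow> 'a list" where
  "edge_source (Edge \<alpha> r \<epsilon> \<beta>) = \<alpha> @ side r \<epsilon> @ \<beta>"

fun edge_target :: "'a edge \<Rightarrow> 'a list" where
  "edge_target (Edge \<alpha> r \<epsilon> \<beta>) = \<alpha> @ side r (\<not> \<epsilon>) @ \<beta>"

fun edge_inv :: "'a edge \<Rightarrow> 'a edge" where
  "edge_inv (Edge \<alpha> r \<epsilon> \<beta>) = Edge \<alpha> r (\<not> \<epsilon>) \<beta>"

fun edge_act :: "'a list \<Rightarrow> 'a edge \<Rightarrow> 'a list \<Rightarrow> 'a edge" where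
  "edge_act \<gamma> (Edge \<alpha> r \<epsilon> \<beta>) \<delta> = Edge (\<gamma> @ \<alpha>) r \<epsilon> (\<beta> @ \<delta>)"

fun path_act :: "'a list \<Rightarrow> ('a list, 'a edge) path \<Rightarrow> 'a list \<Rightarrow> ('a list, 'a edge) path" where
  "path_act \<gamma> (v, p) \<delta> = (\<gamma> @ v @ \<delta>, map (\<lambda>e. edge_act \<gamma> e \<delta>) p)"

definition derivation_graph :: "'a presentation \<Rightarrow> ('a list, 'a edge) pre_digraph" where
  "derivation_graph P =
    \<lparr>verts = lists (gens P),
     arcs = {Edge \<alpha> r \<epsilon> \<beta> | \<alpha> r \<epsilon> \<beta>. \<alpha> \<in> lists (gens P) \<and> r \<in> rels P \<and> \<beta> \<in> lists (gens P)},
     tail = edge_source, head = edge_target\<rparr>"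

definition interchange_path :: "'a edge \<Rightarrow> 'a edge \<Rightarrow> ('a list, 'a edge) path" where
  "interchange_path e f = (edge_source e @ edge_source f,
    [edge_act [] e (edge_source f),
     edge_act (edge_target e) f [],
     edge_act [] (edge_inv e) (edge_target f),
     edge_act (edge_source e) (edge_inv f) []])"

definition squier_complex :: "'a presentation \<Rightarrow> ('a list, 'a edge) two_complex" where
  "squier_complex P =
    \<lparr>skeleton = derivation_graph P,
     arc_inv = edge_inv,
     defining = {interchange_path e f | e f.
       e \<in> arcs (derivation_graph P) \<and> f \<in> arcs (derivation_graph P)}\<rparr>"

definition adjoin_translates ::
  "'a presentation \<Rightarrow> ('a list, 'a edge) path set \<Rightarrow> ('a list, 'a edge) two_complex" where
  "adjoin_translates P X = squier_complex P\<lparr>defining := defining (squier_complex P) \<union>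
    {path_act \<alpha> c \<beta> | \<alpha> c \<beta>. \<alpha> \<in> lists (gens P) \<and> c \<in> X \<and> \<beta> \<in> lists (gens P)}\<rparr>"

definition homotopy_base :: "'a presentation \<Rightarrow> ('a list, 'a edge) path set \<Rightarrow> bool" where
  "homotopy_base P X \<longleftrightarrow> X \<subseteq> closed_paths (squier_complex P) \<and>
    (\<forall>(v, p) \<in> closed_paths (squier_complex P). homotopic (adjoin_translates P X) (v, p) (v, []))"

definition presentation_FDT :: "'a presentation \<Rightarrow> bool" where
  "presentation_FDT P \<longleftrightarrow> (\<exists>X. finite X \<and> homotopy_base P X)"

text \<open>Letters are taken to be natural numbers, which is no restriction: every finite alphabet
  can be renamed injectively into \<open>nat\<close>.\<close>

definition monoid_FDT :: "('a, 'm) monoid_scheme \<Rightarrow> bool" where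
  "monoid_FDT S \<longleftrightarrow> (\<exists>P :: nat presentation.
    finite_presentation P \<and> presented_monoid P \<cong> S \<and> presentation_FDT P)"

end

theory Submission
  imports Defs
begin

text \<open>Let \<open>L\<close> be the \<open>\<L>\<close>-class of \<open>H\<close> and \<open>G\<close> the Schuetzenberger group, which acts on \<open>L\<close> on the
  right with the \<open>\<H>\<close>-classes in \<open>L\<close> as orbits. A cut \<open>xy\<close> of an element of \<open>L\<close> has, up to the
  \<open>\<L>\<close>-class of \<open>x\<close> and the \<open>\<H>\<close>-class of \<open>xy\<close>, only finitely many types; choosing a representative
  for each type, moving the cut past one letter produces an element of \<open>G\<close>, and there are finitely
  many such labels. Reading off labels turns words over the generators of \<open>S\<close> representing elements of
  \<open>L\<close> into words over the labels, and is compatible with contexts; so it maps the Squier complex of \<open>S\<close>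
  over \<open>L\<close> to that of a finite presentation of \<open>G\<close>, once the images of the relations and of the
  homotopy base, finitely many each, are added. Conversely a word \<open>w\<close> over the labels lifts to a word
  for \<open>hw\<close> with \<open>h \<in> H\<close>, and \<open>w\<close> is recovered up to a natural path \<open>eta\<close>. A relation in a context
  \<open>\<alpha>_\<beta>\<close> is lifted by rewriting \<open>h\<alpha>\<close> as \<open>ch\<close>; so naturality of \<open>eta\<close> needs only one further closed
  path for each relation and each type of \<open>c\<close>. A closed path in the complex of \<open>G\<close> is then homotopic
  to a conjugate of the image of a closed path in the complex of \<open>S\<close>, which is null-homotopic.\<close>

section \<open>Homotopy of paths in 2-complexes\<close>

text \<open>The path calculus needs only a formal inverse on arcs. The defining paths stay
  arbitrary, so that everything applies to the complexes of both presentations with any adjoined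
  closed paths.\<close>

locale involutive_complex =
  fixes K :: "('v, 'e) two_complex"
  assumes wf_skeleton: "wf_digraph (skeleton K)"
    and inv_inv [simp]: "arc_inv K (arc_inv K e) = e"
    and inv_in_arcs: "e \<in> arcs (skeleton K) \<Longrightarrow> arc_inv K e \<in> arcs (skeleton K)"
    and tail_inv: "e \<in> arcs (skeleton K) \<Longrightarrow> tail (skeleton K) (arc_inv K e) = head (skeleton K) e"
begin

interpretation wf_digraph "skeleton K"
  by (rule wf_skeleton)

lemma ends_in_verts:
  "e \<in> arcs (skeleton K) \<Longrightarrow> tail (skeleton K) e \<in> verts (skeleton K)"
  "e \<in> arcs (skeleton K) \<Longrightarrow> head (skeleton K) e \<in> verts (skeleton K)"
  by simp_all

lemma head_inv: "e \<in> arcs (skeleton K) \<Longrightarrow> head (skeleton K) (arc_inv K e) = tail (skeleton K) e"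
  using tail_inv[OF inv_in_arcs] by simp

lemma path_Nil [simp]: "path_betw K u [] v \<longleftrightarrow> u = v \<and> u \<in> verts (skeleton K)"
  by (simp add: path_betw_def awalk_Nil_iff)

lemma path_Cons [simp]: "path_betw K u (e # p) v \<longleftrightarrow>
    e \<in> arcs (skeleton K) \<and> tail (skeleton K) e = u \<and> path_betw K (head (skeleton K) e) p v"
  by (auto simp: path_betw_def awalk_Cons_iff)

lemma path_verts: "path_betw K u p v \<Longrightarrow> u \<in> verts (skeleton K) \<and> v \<in> verts (skeleton K)"
  by (auto simp: path_betw_def)

lemma path_append_iff: "path_betw K u (p @ q) w \<longleftrightarrow> (\<exists>v. path_betw K u p v \<and> path_betw K v q w)"
  by (induction p arbitrary: u) (auto dest: path_verts)

lemma path_append: "path_betw K u p v \<Longrightarrow> path_betw K v q w \<Longrightarrow> path_betw K u (p @ q) w"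
  by (auto simp: path_append_iff)

lemma path_end_unique: "path_betw K u p v \<Longrightarrow> path_betw K u p w \<Longrightarrow> v = w"
  by (induction p arbitrary: u) auto

lemma path_start_unique: "path_betw K u p w \<Longrightarrow> path_betw K v p w \<Longrightarrow> u = v"
  by (cases p) auto

lemma inv_arcs_Nil [simp]: "inv_arcs K [] = []"
  by (simp add: inv_arcs_def)

lemma inv_arcs_Cons [simp]: "inv_arcs K (e # p) = inv_arcs K p @ [arc_inv K e]"
  by (simp add: inv_arcs_def)

lemma inv_arcs_append [simp]: "inv_arcs K (p @ q) = inv_arcs K q @ inv_arcs K p"
  by (simp add: inv_arcs_def)

lemma inv_arcs_inv [simp]: "inv_arcs K (inv_arcs K p) = p"
  by (induction p) auto

lemma path_inv: "path_betw K u p v \<Longrightarrow> path_betw K v (inv_arcs K p) u"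
proof (induction p arbitrary: u)
  case (Cons e p)
  then show ?case
    by (auto intro!: path_append[where v = "head (skeleton K) e"]
        simp: inv_in_arcs tail_inv head_inv)
qed simp

lemma move_path:
  assumes "homotopy_move K (u, p) (u', q)"
  shows "u' = u \<and> (path_betw K u p v \<longleftrightarrow> path_betw K u q v)"
  using assms
proof cases
  case (replace p x a y b q w)
  have "path_betw K u (p @ a @ q) w" "path_betw K u (p @ b @ q) w"
    using replace by (auto intro: path_append)
  then show ?thesis
    using replace path_end_unique by blast
next
  case (insert p x e q w)
  have "path_betw K u (p @ q) w" "path_betw K u (p @ [e, arc_inv K e] @ q) w"
    using insert by (auto intro!: path_append)
  then show ?thesis
    using insert path_end_unique by blast
next
  case (delete p x e q w)
  have "path_betw K u (p @ q) w" "path_betw K u (p @ [e, arc_inv K e] @ q) w"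
    using delete by (auto intro!: path_append)
  then show ?thesis
    using delete path_end_unique by blast
qed

lemma homotopic_path:
  assumes "homotopic K (u, p) (u', q)"
  shows "u' = u \<and> (path_betw K u p v \<longleftrightarrow> path_betw K u q v)"
proof -
  have "(homotopy_move K)\<^sup>*\<^sup>* (u, p) (u', q)"
    using assms by (simp add: homotopic_def)
  then have "fst (u', q) = u \<and> (path_betw K u p v \<longleftrightarrow> path_betw K u (snd (u', q)) v)"
  proof (induction rule: rtranclp_induct)
    case (step y z)
    then show ?case
      using move_path[of u "snd y" "fst z" "snd z" v] by (metis prod.collapse)
  qed simp
  then show ?thesis by simp
qed

text \<open>A rotation of a closed path inverts to a rotation of the inverse path, starting at the
  same vertex. This makes the \<open>replace\<close> move reversible.\<close>

lemma relators_inv: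
  assumes "(v, p) \<in> relators K" "path_betw K v p v"
  shows "(v, inv_arcs K p) \<in> relators K"
proof -
  let ?D = "defining K \<union> {(v, inv_arcs K p) | v p. (v, p) \<in> defining K}"
  obtain u a b where *: "p = b @ a" "(u, a @ b) \<in> ?D" "path_betw K u a v"
    using assms(1) by (auto simp: relators_def cyclic_perms_def)
  have "path_betw K v b u"
    using assms(2) * by (metis path_append_iff path_start_unique)
  then have **: "path_betw K u (inv_arcs K b) v"
    by (rule path_inv)
  have "(u, inv_arcs K b @ inv_arcs K a) \<in> ?D"
    using *(2) by auto (metis inv_arcs_append inv_arcs_inv)
  with ** show ?thesis
    unfolding relators_def cyclic_perms_def *(1) by auto
qed

lemma move_sym:
  assumes "homotopy_move K x y"
  shows "homotopy_move K y x"
  using assms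
proof cases
  case (replace u p v a v' b q w)
  have "path_betw K v (a @ inv_arcs K b) v"
    using replace path_inv path_append by blast
  then have "(v, b @ inv_arcs K a) \<in> relators K"
    using relators_inv[of v "a @ inv_arcs K b"] replace by simp
  then show ?thesis
    using replace homotopy_move.replace by metis
next
  case (insert u p v e q w)
  then show ?thesis by (metis homotopy_move.delete)
next
  case (delete u p v e q w)
  then show ?thesis by (metis homotopy_move.insert)
qed

lemma move_append:
  assumes "homotopy_move K (v, a) (v, b)" "path_betw K u p v" "path_betw K v a w" "path_betw K w q x"
  shows "homotopy_move K (u, p @ a @ q) (u, p @ b @ q)"
  using assms(1)
proof cases
  case (insert p' v' e q' w')
  then have "path_betw K u (p @ p') v'" "path_betw K v' (q' @ q) x"
    using assms by (auto simp: path_append_iff inv_in_arcs tail_inv head_inv) (metis path_end_unique)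
  then show ?thesis
    using homotopy_move.insert[of K u "p @ p'" v' e "q' @ q" x] insert path_verts by simp
next
  case (delete p' v' e q' w')
  then have "path_betw K u (p @ p') v'" "path_betw K v' (q' @ q) x"
    using assms by (auto simp: path_append_iff inv_in_arcs tail_inv head_inv)
  then show ?thesis
    using homotopy_move.delete[of K u "p @ p'" v' e "q' @ q" x] delete path_verts by simp
next
  case (replace p' v' a' v'' b' q' w')
  then have "path_betw K u (p @ p') v'" "path_betw K v'' (q' @ q) x"
    using assms by (auto simp: path_append_iff) (metis path_end_unique)+
  then show ?thesis
    using homotopy_move.replace[of K u "p @ p'" v' a' v'' b' "q' @ q" x] replace by simp
qed

text \<open>Fixes both ends and includes that \<open>p\<close> is a path, so that homotopies compose
  and chain with few side conditions. That \<open>q\<close> is a path between the same ends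
  follows.\<close>

definition htpy :: "'v \<Rightarrow> 'e list \<Rightarrow> 'e list \<Rightarrow> 'v \<Rightarrow> bool" where
  "htpy u p q v \<longleftrightarrow> path_betw K u p v \<and> homotopic K (u, p) (u, q)"

lemma htpy_path: "htpy u p q v \<Longrightarrow> path_betw K u p v \<and> path_betw K u q v"
  using homotopic_path[of u p u q v] by (simp add: htpy_def)

lemma htpy_refl: "path_betw K u p v \<Longrightarrow> htpy u p p v"
  by (simp add: htpy_def homotopic_def)

lemma htpy_sym: "htpy u p q v \<Longrightarrow> htpy u q p v"
proof -
  assume *: "htpy u p q v"
  have "symp (homotopy_move K)"
    using move_sym by (auto simp: symp_def)
  then have "homotopic K (u, q) (u, p)"
    using * by (auto simp: htpy_def homotopic_def dest: symp_rtranclp sympD)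
  then show ?thesis
    using htpy_path[OF *] by (simp add: htpy_def)
qed

lemma htpy_trans [trans]: "htpy u p q v \<Longrightarrow> htpy u q r v \<Longrightarrow> htpy u p r v"
  by (auto simp: htpy_def homotopic_def)

lemma htpy_context:
  assumes "htpy v a b w" "path_betw K u p v" "path_betw K w q x"
  shows "htpy u (p @ a @ q) (p @ b @ q) x"
proof -
  have path: "path_betw K v a w"
    using assms(1) by (simp add: htpy_def)
  have "(homotopy_move K)\<^sup>*\<^sup>* (v, a) (v, b)"
    using assms(1) by (simp add: htpy_def homotopic_def)
  then have "fst (v, b) = v \<and> htpy u (p @ a @ q) (p @ snd (v, b) @ q) x \<and> path_betw K v (snd (v, b)) w"
  proof (induction rule: rtranclp_induct)
    case base
    show ?case
      using path assms by (auto intro!: htpy_refl path_append)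
  next
    case (step y z)
    obtain c d where yz: "y = (v, c)" "z = (v, d)"
      using step move_path[of "fst y" "snd y" "fst z" "snd z" w]
      by (metis prod.collapse)
    have "homotopy_move K (u, p @ c @ q) (u, p @ d @ q)"
      using move_append step assms yz by fastforce
    then have "htpy u (p @ a @ q) (p @ d @ q) x"
      using step yz by (auto simp: htpy_def homotopic_def)
    moreover have "path_betw K v d w"
      using step yz move_path by fastforce
    ultimately show ?case
      using yz by simp
  qed
  then show ?thesis by simp
qed

lemma htpy_append:
  assumes "htpy u p p' v" "htpy v q q' w"
  shows "htpy u (p @ q) (p' @ q') w"
proof -
  have "htpy u ([] @ p @ q) ([] @ p' @ q) w"
    using assms by (intro htpy_context) (auto dest: htpy_path path_verts)
  moreover have "htpy u (p' @ q @ []) (p' @ q' @ []) w"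
    using assms by (intro htpy_context) (auto dest: htpy_path path_verts)
  ultimately show ?thesis
    by (auto intro: htpy_trans)
qed

lemma htpy_append_left: "path_betw K u p v \<Longrightarrow> htpy v q q' w \<Longrightarrow> htpy u (p @ q) (p @ q') w"
  by (rule htpy_append[OF htpy_refl])

lemma htpy_append_right: "htpy u p p' v \<Longrightarrow> path_betw K v q w \<Longrightarrow> htpy u (p @ q) (p' @ q) w"
  by (rule htpy_append[OF _ htpy_refl])

lemma htpy_inv_right: "path_betw K u p v \<Longrightarrow> htpy u (p @ inv_arcs K p) [] u"
proof (induction p arbitrary: u)
  case (Cons e p)
  let ?h = "head (skeleton K) e"
  have e: "e \<in> arcs (skeleton K)" "tail (skeleton K) e = u"
    and p: "path_betw K ?h p v"
    using Cons.prems by auto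
  have "htpy u ([e] @ (p @ inv_arcs K p) @ [arc_inv K e]) ([e] @ [] @ [arc_inv K e]) u"
    using Cons.IH[OF p] e path_verts[OF p] by (intro htpy_context) (auto simp: inv_in_arcs tail_inv head_inv)
  moreover have "htpy u ([] @ [e, arc_inv K e] @ []) ([] @ []) u"
    unfolding htpy_def homotopic_def
    using e path_verts[OF p]
    by (intro conjI r_into_rtranclp homotopy_move.delete[where v = u and w = u])
       (auto simp: inv_in_arcs tail_inv head_inv)
  ultimately show ?case
    by (auto intro: htpy_trans)
qed (auto intro: htpy_refl)

lemma htpy_inv_left: "path_betw K u p v \<Longrightarrow> htpy v (inv_arcs K p @ p) [] v"
  using htpy_inv_right[OF path_inv] by fastforce

text \<open>No move is inverted. Behind the inverse of \<open>p\<close>, insert \<open>q\<close>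
  followed by its inverse, exchange that \<open>q\<close> for \<open>p\<close>, and cancel.\<close>

lemma htpy_inv:
  assumes "htpy u p q v"
  shows "htpy v (inv_arcs K p) (inv_arcs K q) u"
proof -
  have p: "path_betw K u p v" and q: "path_betw K u q v"
    using htpy_path[OF assms] by auto
  have "htpy v (inv_arcs K p) (inv_arcs K p @ q @ inv_arcs K q) u"
    using htpy_append_left[OF path_inv[OF p] htpy_sym[OF htpy_inv_right[OF q]]] by simp
  also have "htpy v (inv_arcs K p @ q @ inv_arcs K q) (inv_arcs K p @ p @ inv_arcs K q) u"
    by (rule htpy_context[OF htpy_sym[OF assms] path_inv[OF p] path_inv[OF q]])
  also have "htpy v (inv_arcs K p @ p @ inv_arcs K q) (inv_arcs K q) u"
    using htpy_append_right[OF htpy_inv_left[OF p] path_inv[OF q]] by simp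
  finally show ?thesis .
qed

lemma htpy_of_closed:
  assumes "htpy u (p @ inv_arcs K q) [] u" "path_betw K u p v" "path_betw K u q v"
  shows "htpy u p q v"
proof -
  have "htpy u p (p @ inv_arcs K q @ q) v"
    using htpy_append_left[OF assms(2) htpy_sym[OF htpy_inv_left[OF assms(3)]]] by simp
  also have "htpy u (p @ inv_arcs K q @ q) q v"
    using htpy_append_right[OF assms(1,3)] by simp
  finally show ?thesis .
qed

lemma htpy_cancel_right:
  assumes "htpy u (p @ r) (q @ r) w" "path_betw K u p v" "path_betw K u q v"
  shows "htpy u p q v"
proof -
  have r: "path_betw K v r w"
    using htpy_path[OF assms(1)] assms(2) by (metis path_append_iff path_end_unique)
  have "htpy u p (p @ r @ inv_arcs K r) v"
    using htpy_append_left[OF assms(2) htpy_sym[OF htpy_inv_right[OF r]]] by simp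
  also have "htpy u (p @ r @ inv_arcs K r) (q @ r @ inv_arcs K r) v"
    using htpy_append_right[OF assms(1) path_inv[OF r]] by simp
  also have "htpy u (q @ r @ inv_arcs K r) q v"
    using htpy_append_left[OF assms(3) htpy_inv_right[OF r]] by simp
  finally show ?thesis .
qed

text \<open>Conjugation by \<open>p\<close>: a cancelling pair of \<open>p\<close> is inserted in
  front, and the closed path that then appears in the middle is contracted.\<close>

lemma htpy_rotate:
  assumes "htpy u (p @ q) [] u" "path_betw K u p v" "path_betw K v q u"
  shows "htpy v (q @ p) [] v"
proof -
  have "htpy v (q @ p) (inv_arcs K p @ p @ q @ p) v"
    using htpy_append_right[OF htpy_sym[OF htpy_inv_left[OF assms(2)]] path_append[OF assms(3,2)]]
    by simp
  also have "htpy v (inv_arcs K p @ p @ q @ p) (inv_arcs K p @ [] @ p) v"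
    using htpy_context[OF assms(1) path_inv[OF assms(2)] assms(2)] by simp
  also have "htpy v (inv_arcs K p @ [] @ p) [] v"
    using htpy_inv_left[OF assms(2)] by simp
  finally show ?thesis by simp
qed

lemma htpy_defining:
  assumes "(v, p) \<in> defining K" "path_betw K v p v"
  shows "htpy v p [] v"
proof -
  \<comment> \<open>\<open>replace\<close> asks for a cyclic permutation; the rotation by the empty
    path is used, and the replacing path is empty.\<close>
  have "(v, [] @ p) \<in> defining K" "path_betw K v [] v"
    using assms path_verts by auto
  then have "(v, p @ []) \<in> relators K"
    unfolding relators_def cyclic_perms_def by blast
  then have "homotopy_move K (v, [] @ p @ []) (v, [] @ [] @ [])"
    using assms path_verts by (intro homotopy_move.replace) auto
  then show ?thesis
    using assms by (auto simp: htpy_def homotopic_def)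
qed

end

section \<open>Maps between 2-complexes\<close>

lemma path_map:
  assumes "involutive_complex K" "involutive_complex K'"
    and V: "\<And>e. e \<in> arcs (skeleton K) \<Longrightarrow> tail (skeleton K) e \<in> V \<longleftrightarrow> head (skeleton K) e \<in> V"
    and F: "\<And>v. v \<in> V \<Longrightarrow> v \<in> verts (skeleton K) \<Longrightarrow> F v \<in> verts (skeleton K')"
    and f: "\<And>e. e \<in> arcs (skeleton K) \<Longrightarrow> tail (skeleton K) e \<in> V \<Longrightarrow>
      f e \<in> arcs (skeleton K') \<and> tail (skeleton K') (f e) = F (tail (skeleton K) e) \<and>
      head (skeleton K') (f e) = F (head (skeleton K) e)"
    and "path_betw K u p v" "u \<in> V"
  shows "path_betw K' (F u) (map f p) (F v) \<and> v \<in> V"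
proof -
  interpret K: involutive_complex K by fact
  interpret K': involutive_complex K' by fact
  from \<open>path_betw K u p v\<close> \<open>u \<in> V\<close> show ?thesis
    by (induction p arbitrary: u) (use V F f in auto)
qed

text \<open>The subset \<open>V\<close> is a union of connected components; a map of complexes need only be defined
  there.\<close>

lemma homotopic_map:
  assumes "involutive_complex K" "involutive_complex K'"
    and V: "\<And>e. e \<in> arcs (skeleton K) \<Longrightarrow> tail (skeleton K) e \<in> V \<longleftrightarrow> head (skeleton K) e \<in> V"
    and F: "\<And>v. v \<in> V \<Longrightarrow> v \<in> verts (skeleton K) \<Longrightarrow> F v \<in> verts (skeleton K')"
    and f: "\<And>e. e \<in> arcs (skeleton K) \<Longrightarrow> tail (skeleton K) e \<in> V \<Longrightarrow>
      f e \<in> arcs (skeleton K') \<and> tail (skeleton K') (f e) = F (tail (skeleton K) e) \<and>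
      head (skeleton K') (f e) = F (head (skeleton K) e)"
    and f_inv: "\<And>e. e \<in> arcs (skeleton K) \<Longrightarrow> tail (skeleton K) e \<in> V \<Longrightarrow>
      f (arc_inv K e) = arc_inv K' (f e)"
    and defining: "\<And>v p. (v, p) \<in> defining K \<Longrightarrow> path_betw K v p v \<Longrightarrow> v \<in> V \<Longrightarrow>
      involutive_complex.htpy K' (F v) (map f p) [] (F v)"
    and hom: "involutive_complex.htpy K u p q w" "u \<in> V"
  shows "involutive_complex.htpy K' (F u) (map f p) (map f q) (F w)"
proof -
  interpret K: involutive_complex K by fact
  interpret K': involutive_complex K' by fact
  have path: "path_betw K' (F u) (map f p) (F v) \<and> v \<in> V"
    if "path_betw K u p v" "u \<in> V" for u p v
    by (rule path_map[where V = V and F = F and f = f, OF assms(1,2) _ _ _ that]) (fact V F f)+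
  have map_inv: "map f (inv_arcs K p) = inv_arcs K' (map f p)"
    if "path_betw K u p w" "u \<in> V" for u p w
    using that by (induction p arbitrary: u) (use V f_inv in auto)
  have move: "K'.htpy (F u) (map f p) (map f q) (F w)"
    if "homotopy_move K (u, p) (u, q)" "path_betw K u p w" "u \<in> V" for u p q w
    using that(1)
  proof cases
    case (insert p' v e q' w')
    have v: "v \<in> V" and p: "path_betw K' (F u) (map f p') (F v)"
      using path[OF insert(3) that(3)] by auto
    have e: "path_betw K' (F v) [f e] (F (head (skeleton K) e))"
      using path[of v "[e]" "head (skeleton K) e"] insert(4) v K.ends_in_verts(2)[of e] by auto
    have "w' = w"
      using K.path_end_unique[OF K.path_append[OF insert(3,5)]] that(2) insert(1) by simp
    then have q: "path_betw K' (F v) (map f q') (F w)"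
      using path[OF insert(5)] v by simp
    have "K'.htpy (F u) (map f p' @ ([f e] @ inv_arcs K' [f e]) @ map f q') (map f p' @ [] @ map f q') (F w)"
      by (rule K'.htpy_context[OF K'.htpy_inv_right[OF e] p q])
    from K'.htpy_sym[OF this] show ?thesis
      using insert v f_inv by auto
  next
    case (delete p' v e q' w')
    have v: "v \<in> V" and p: "path_betw K' (F u) (map f p') (F v)"
      using path[OF delete(3) that(3)] by auto
    have e: "path_betw K' (F v) [f e] (F (head (skeleton K) e))"
      using path[of v "[e]" "head (skeleton K) e"] delete(4) v K.ends_in_verts(2)[of e] by auto
    have "w' = w"
      using K.path_end_unique[OF K.path_append[OF delete(3,5)]] that(2) delete(2)
        K.move_path[OF that(1)] by simp
    then have q: "path_betw K' (F v) (map f q') (F w)"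
      using path[OF delete(5)] v by simp
    have "K'.htpy (F u) (map f p' @ ([f e] @ inv_arcs K' [f e]) @ map f q') (map f p' @ [] @ map f q') (F w)"
      by (rule K'.htpy_context[OF K'.htpy_inv_right[OF e] p q])
    then show ?thesis
      using delete v f_inv by auto
  next
    case (replace p' v a v' b q' w')
    have v: "v \<in> V" and p: "path_betw K' (F u) (map f p') (F v)"
      using path[OF replace(3) that(3)] by auto
    have v': "v' \<in> V" and a: "path_betw K' (F v) (map f a) (F v')" and b: "path_betw K' (F v) (map f b) (F v')"
      using path[OF replace(4) v] path[OF replace(5) v] by auto
    have "w' = w"
      using K.path_end_unique[OF K.path_append[OF replace(3) K.path_append[OF replace(4,6)]]]
        that(2) replace(1) by simp
    then have q: "path_betw K' (F v') (map f q') (F w)"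
      using path[OF replace(6) v'] by simp
    have ab: "path_betw K v (a @ inv_arcs K b) v"
      using replace K.path_append K.path_inv by blast
    \<comment> \<open>The relator read from \<open>v\<close> is a rotation of a defining path at
      \<open>x\<close>, or of the inverse of one. It is contracted at \<open>x\<close>, where the
      hypothesis applies, and rotated back afterwards.\<close>
    obtain x c d where cd: "a @ inv_arcs K b = d @ c" "path_betw K x c v"
      and D: "(x, c @ d) \<in> defining K \<or> (\<exists>r. c @ d = inv_arcs K r \<and> (x, r) \<in> defining K)"
      using replace by (auto simp: relators_def cyclic_perms_def)
    have d: "path_betw K v d x"
      using ab cd by (metis K.path_append_iff K.path_start_unique)
    have x: "x \<in> V"
      using path[OF d v] by simp
    have cd': "path_betw K x (c @ d) x"
      using cd d K.path_append by blast
    have "K'.htpy (F x) (map f (c @ d)) [] (F x)"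
      using D
    proof (elim disjE exE conjE)
      \<comment> \<open>The hypothesis covers \<open>r\<close> itself; inverting the resulting
        homotopy settles its inverse.\<close>
      fix r assume r: "c @ d = inv_arcs K r" "(x, r) \<in> defining K"
      have "path_betw K x r x"
        using K.path_inv[OF cd'] r(1) by simp
      then have "K'.htpy (F x) (map f r) [] (F x)"
        using r(2) x by (intro defining)
      then have "K'.htpy (F x) (inv_arcs K' (map f r)) (inv_arcs K' []) (F x)"
        by (rule K'.htpy_inv)
      then show ?thesis
        unfolding r(1) map_inv[OF \<open>path_betw K x r x\<close> x] by simp
    next
      assume "(x, c @ d) \<in> defining K"
      then show ?thesis
        using cd' x by (rule defining)
    qed
    then have "K'.htpy (F v) (map f (a @ inv_arcs K b)) [] (F v)"
      unfolding cd(1) map_append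
      using K'.htpy_rotate[of "F x" "map f c" "map f d" "F v"] path[OF cd(2) x] path[OF d v] by simp
    then have "K'.htpy (F v) (map f a) (map f b) (F v')"
      using K'.htpy_of_closed[OF _ a b] map_inv[OF replace(5) v] by simp
    then show ?thesis
      unfolding replace(1,2) map_append by (rule K'.htpy_context[OF _ p q])
  qed
  have "(homotopy_move K)\<^sup>*\<^sup>* (u, p) (u, q)" and p: "path_betw K u p w"
    using hom by (auto simp: K.htpy_def homotopic_def)
  from this(1) have "fst (u, q) = u \<and> path_betw K u (snd (u, q)) w \<and>
      K'.htpy (F u) (map f p) (map f (snd (u, q))) (F w)"
  proof (induction rule: rtranclp_induct)
    case base
    then show ?case
      using p K'.htpy_refl[OF conjunct1[OF path[OF p hom(2)]]] by simp
  next
    case (step y z)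
    obtain c where y: "y = (u, c)"
      using step(3) by (cases y) auto
    obtain d where z: "z = (u, d)"
      using K.move_path[of u c "fst z" "snd z"] step(2) y by (cases z) auto
    have c: "homotopy_move K (u, c) (u, d)" "path_betw K u c w"
      using step(2,3) y z by simp_all
    then have "K'.htpy (F u) (map f c) (map f d) (F w)" "path_betw K u d w"
      using move[OF c hom(2)] K.move_path[OF c(1)] by simp_all
    then show ?case
      using step(3) y z K'.htpy_trans[of "F u" "map f p" "map f c" "F w" "map f d"] by simp
  qed
  then show ?thesis by simp
qed

section \<open>The monoidal structure of the Squier complex\<close>

declare in_lists_conv_set [simp del] in_listsI [rule del] in_listsD [rule del] path_act.simps [simp del]

lemma edge_source_act [simp]: "edge_source (edge_act \<gamma> e \<delta>) = \<gamma> @ edge_source e @ \<delta>"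
  by (cases e) auto

lemma edge_target_act [simp]: "edge_target (edge_act \<gamma> e \<delta>) = \<gamma> @ edge_target e @ \<delta>"
  by (cases e) auto

lemma edge_act_Nil [simp]: "edge_act [] e [] = e"
  by (cases e) auto

lemma edge_act_act [simp]: "edge_act \<gamma> (edge_act \<gamma>' e \<delta>') \<delta> = edge_act (\<gamma> @ \<gamma>') e (\<delta>' @ \<delta>)"
  by (cases e) auto

lemma edge_inv_act [simp]: "edge_inv (edge_act \<gamma> e \<delta>) = edge_act \<gamma> (edge_inv e) \<delta>"
  by (cases e) auto

lemma edge_inv_inv [simp]: "edge_inv (edge_inv e) = e"
  by (cases e) auto

lemma edge_source_inv [simp]: "edge_source (edge_inv e) = edge_target e"
  by (cases e) auto

lemma edge_target_inv [simp]: "edge_target (edge_inv e) = edge_source e"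
  by (cases e) auto

text \<open>Acts on the arcs alone, without the initial vertex carried by \<open>path_act\<close>,
  to fit the separate vertex argument of \<open>htpy\<close>.\<close>

definition act :: "'a list \<Rightarrow> 'a edge list \<Rightarrow> 'a list \<Rightarrow> 'a edge list" where
  "act \<gamma> p \<delta> = map (\<lambda>e. edge_act \<gamma> e \<delta>) p"

lemma act_simps [simp]:
  "act \<gamma> [] \<delta> = []"
  "act \<gamma> (e # p) \<delta> = edge_act \<gamma> e \<delta> # act \<gamma> p \<delta>"
  "act \<gamma> (p @ q) \<delta> = act \<gamma> p \<delta> @ act \<gamma> q \<delta>"
  "act \<gamma> (act \<gamma>' p \<delta>') \<delta> = act (\<gamma> @ \<gamma>') p (\<delta>' @ \<delta>)"
  "act [] p [] = p"
  by (auto simp: act_def map_idI)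

lemma path_act_eq: "path_act \<gamma> (v, p) \<delta> = (\<gamma> @ v @ \<delta>, act \<gamma> p \<delta>)"
  by (simp add: act_def path_act.simps)

lemma interchange_path_act:
  "interchange_path e f = (v, p) \<Longrightarrow>
    interchange_path (edge_act \<gamma> e []) (edge_act [] f \<delta>) = (\<gamma> @ v @ \<delta>, act \<gamma> p \<delta>)"
  by (auto simp: interchange_path_def)

text \<open>\<open>X\<close> need not be a homotopy base. The locale serves the given base of
  \<open>P\<close>, the empty set, and the family whose base property is to be proved.\<close>

locale squier =
  fixes P :: "'a presentation" and X :: "('a list, 'a edge) path set"
  assumes presentation: "is_presentation P"
    and closed: "X \<subseteq> closed_paths (squier_complex P)"
begin

abbreviation A where "A \<equiv> lists (gens P)"

abbreviation K where "K \<equiv> adjoin_translates P X"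

lemma K_simps [simp]:
  "skeleton K = derivation_graph P"
  "arc_inv K = edge_inv"
  by (simp_all add: adjoin_translates_def squier_complex_def)

lemma derivation_graph_simps [simp]:
  "verts (derivation_graph P) = A"
  "tail (derivation_graph P) = edge_source"
  "head (derivation_graph P) = edge_target"
  by (simp_all add: derivation_graph_def)

lemma Edge_in_arcs [simp]:
  "Edge \<alpha> r \<epsilon> \<beta> \<in> arcs (derivation_graph P) \<longleftrightarrow> \<alpha> \<in> A \<and> r \<in> rels P \<and> \<beta> \<in> A"
  by (cases r) (simp add: derivation_graph_def)

lemma rels_in_words: "(u, v) \<in> rels P \<Longrightarrow> u \<in> A \<and> v \<in> A"
  using presentation by (auto simp: is_presentation_def)

lemma arc_ends_in_words:
  assumes "e \<in> arcs (derivation_graph P)"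
  shows "edge_source e \<in> A" "edge_target e \<in> A"
proof -
  obtain \<alpha> r \<epsilon> \<beta> where "e = Edge \<alpha> r \<epsilon> \<beta>" by (cases e)
  with assms rels_in_words[of "fst r" "snd r"] show "edge_source e \<in> A" "edge_target e \<in> A"
    by (cases \<epsilon>; simp)+
qed

lemma edge_inv_in_arcs [simp]: "edge_inv e \<in> arcs (derivation_graph P) \<longleftrightarrow> e \<in> arcs (derivation_graph P)"
  by (cases e) simp

lemma edge_act_in_arcs [simp]: "\<gamma> \<in> A \<Longrightarrow> \<delta> \<in> A \<Longrightarrow>
    edge_act \<gamma> e \<delta> \<in> arcs (derivation_graph P) \<longleftrightarrow> e \<in> arcs (derivation_graph P)"
  by (cases e) auto

sublocale involutive_complex K
  by unfold_locales (simp_all add: arc_ends_in_words)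

lemma path_squier_iff: "path_betw (squier_complex P) u p v \<longleftrightarrow> path_betw K u p v"
  by (simp add: path_betw_def squier_complex_def)

lemma path_words: "path_betw K u p v \<Longrightarrow> u \<in> A \<and> v \<in> A"
  using path_verts by simp

lemma path_act: "\<gamma> \<in> A \<Longrightarrow> \<delta> \<in> A \<Longrightarrow> path_betw K u p v \<Longrightarrow>
    path_betw K (\<gamma> @ u @ \<delta>) (act \<gamma> p \<delta>) (\<gamma> @ v @ \<delta>)"
  by (induction p arbitrary: u) auto

lemma path_lact: "\<gamma> \<in> A \<Longrightarrow> path_betw K u p v \<Longrightarrow> path_betw K (\<gamma> @ u) (act \<gamma> p []) (\<gamma> @ v)"
  using path_act[of \<gamma> "[]" u p v] by simp

lemma path_ract: "\<delta> \<in> A \<Longrightarrow> path_betw K u p v \<Longrightarrow> path_betw K (u @ \<delta>) (act [] p \<delta>) (v @ \<delta>)"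
  using path_act[of "[]" \<delta> u p v] by simp

lemma inv_arcs_act: "inv_arcs K (act \<gamma> p \<delta>) = act \<gamma> (inv_arcs K p) \<delta>"
  by (induction p) auto

lemma defining_cases:
  assumes "(v, p) \<in> defining K"
  obtains (interchange) e f where "e \<in> arcs (derivation_graph P)" "f \<in> arcs (derivation_graph P)"
      "(v, p) = interchange_path e f"
    | (translate) \<alpha> u q \<beta> where "\<alpha> \<in> A" "\<beta> \<in> A" "(u, q) \<in> X" "v = \<alpha> @ u @ \<beta>" "p = act \<alpha> q \<beta>"
  using assms
  by (auto simp: adjoin_translates_def squier_complex_def path_act_eq)

lemma defining_interchange:
  "e \<in> arcs (derivation_graph P) \<Longrightarrow> f \<in> arcs (derivation_graph P) \<Longrightarrow>
    interchange_path e f \<in> defining K"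
  by (auto simp: adjoin_translates_def squier_complex_def)

lemma defining_translate:
  assumes "\<alpha> \<in> A" "\<beta> \<in> A" "(u, q) \<in> X"
  shows "(\<alpha> @ u @ \<beta>, act \<alpha> q \<beta>) \<in> defining K"
  unfolding path_act_eq[symmetric] adjoin_translates_def
  using assms by (auto)

lemma htpy_base:
  assumes "(u, p) \<in> X"
  shows "htpy u p [] u"
proof -
  have "path_betw K u p u"
    using assms closed by (auto simp: closed_paths_def path_squier_iff)
  moreover have "(u, p) \<in> defining K"
    using defining_translate[of "[]" "[]" u p] assms by simp
  ultimately show ?thesis
    by (intro htpy_defining)
qed

text \<open>Translation sends defining paths to defining paths: adjoined translates by composing
  contexts, an interchange path because its first edge absorbs \<open>\<gamma>\<close> and its
  second absorbs \<open>\<delta>\<close>.\<close>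

lemma htpy_act:
  assumes "\<gamma> \<in> A" "\<delta> \<in> A" "htpy u p q v"
  shows "htpy (\<gamma> @ u @ \<delta>) (act \<gamma> p \<delta>) (act \<gamma> q \<delta>) (\<gamma> @ v @ \<delta>)"
  unfolding act_def
proof (rule homotopic_map[where K = K and K' = K and V = UNIV and F = "\<lambda>w. \<gamma> @ w @ \<delta>"])
  fix w r assume wr: "(w, r) \<in> defining K" "path_betw K w r w"
  have "(\<gamma> @ w @ \<delta>, act \<gamma> r \<delta>) \<in> defining K"
    using wr(1)
  proof (cases rule: defining_cases)
    case (interchange e f)
    then show ?thesis
      using interchange_path_act[of e f w r] defining_interchange assms
      by (metis edge_act_in_arcs lists.Nil)
  next
    case (translate \<alpha> u q \<beta>)
    then show ?thesis
      using defining_translate[of "\<gamma> @ \<alpha>" "\<beta> @ \<delta>" u q] assms by simp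
  qed
  then show "htpy (\<gamma> @ w @ \<delta>) (map (\<lambda>e. edge_act \<gamma> e \<delta>) r) [] (\<gamma> @ w @ \<delta>)"
    using htpy_defining path_act[OF assms(1,2) wr(2)] by (simp add: act_def)
qed (use assms involutive_complex_axioms in auto)

section \<open>Commutation of derivations in disjoint factors\<close>

lemma interchange_edges:
  assumes "e \<in> arcs (derivation_graph P)" "f \<in> arcs (derivation_graph P)"
  shows "htpy (edge_source e @ edge_source f)
    [edge_act [] e (edge_source f), edge_act (edge_target e) f []]
    [edge_act (edge_source e) f [], edge_act [] e (edge_target f)]
    (edge_target e @ edge_target f)"
proof (rule htpy_of_closed)
  show "htpy (edge_source e @ edge_source f)
      ([edge_act [] e (edge_source f), edge_act (edge_target e) f []] @
        inv_arcs K [edge_act (edge_source e) f [], edge_act [] e (edge_target f)]) []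
      (edge_source e @ edge_source f)"
    using defining_interchange[OF assms] assms
    by (intro htpy_defining) (auto simp: interchange_path_def arc_ends_in_words)
qed (use assms arc_ends_in_words in auto)

lemma interchange_edge_path:
  assumes "e \<in> arcs (derivation_graph P)" "path_betw K w q w'"
  shows "htpy (edge_source e @ w) (edge_act [] e w # act (edge_target e) q [])
    (act (edge_source e) q [] @ [edge_act [] e w']) (edge_target e @ w')"
  using assms(2)
proof (induction q arbitrary: w)
  case Nil
  then show ?case
    using htpy_refl[of "edge_source e @ w'" "[edge_act [] e w']"] assms(1)
    by (auto simp: arc_ends_in_words)
next
  case (Cons f q)
  let ?s = "edge_source e" and ?t = "edge_target e" and ?x = "edge_target f"
  have f: "f \<in> arcs (derivation_graph P)" "w = edge_source f" and q: "path_betw K ?x q w'"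
    using Cons.prems by auto
  have "htpy (?s @ w) ([edge_act [] e w, edge_act ?t f []] @ act ?t q [])
      ([edge_act ?s f [], edge_act [] e ?x] @ act ?t q []) (?t @ w')"
    using interchange_edges[OF assms(1) f(1)] path_lact[OF _ q, of ?t] assms f
    by (intro htpy_append_right) (auto simp: arc_ends_in_words)
  also have "htpy (?s @ w) ([edge_act ?s f [], edge_act [] e ?x] @ act ?t q [])
      ([edge_act ?s f []] @ (act ?s q [] @ [edge_act [] e w'])) (?t @ w')"
    using htpy_append_left[OF _ Cons.IH[OF q], of "?s @ w" "[edge_act ?s f []]"] assms f
    by (simp add: arc_ends_in_words)
  finally show ?case by simp
qed

text \<open>The defining squares treat two single arcs, a first induction moves one arc past a path,
  and this second one moves the whole of \<open>p\<close>.\<close>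

lemma interchange:
  assumes "path_betw K u p u'" "path_betw K w q w'"
  shows "htpy (u @ w) (act [] p w @ act u' q []) (act u q [] @ act [] p w') (u' @ w')"
  using assms(1)
proof (induction p arbitrary: u)
  case Nil
  then show ?case
    using path_lact[OF _ assms(2)] by (auto intro: htpy_refl)
next
  case (Cons e p)
  let ?t = "edge_target e"
  have e: "e \<in> arcs (derivation_graph P)" "u = edge_source e" and p: "path_betw K ?t p u'"
    using Cons.prems by auto
  have w: "w \<in> A" "w' \<in> A"
    using path_words[OF assms(2)] by auto
  have "htpy (u @ w) ([edge_act [] e w] @ (act [] p w @ act u' q []))
      ([edge_act [] e w] @ (act ?t q [] @ act [] p w')) (u' @ w')"
    using Cons.IH[OF p] w e arc_ends_in_words by (intro htpy_append_left) auto
  also have "htpy (u @ w) ([edge_act [] e w] @ (act ?t q [] @ act [] p w'))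
      ((act u q [] @ [edge_act [] e w']) @ act [] p w') (u' @ w')"
    using htpy_append_right[OF interchange_edge_path[OF e(1) assms(2)] path_ract[OF w(2) p]] e(2)
    by simp
  finally show ?case by simp
qed

end

section \<open>Presented monoids\<close>

lemma quot_monoid_simps [simp]:
  "carrier (quot_monoid M r) = carrier M // r"
  "\<one>\<^bsub>quot_monoid M r\<^esub> = r `` {\<one>\<^bsub>M\<^esub>}"
  by (simp_all add: quot_monoid_def)

lemma quot_monoid_mult:
  assumes "equiv (carrier M) r"
    and "\<And>x x' y y'. (x, x') \<in> r \<Longrightarrow> (y, y') \<in> r \<Longrightarrow> (x \<otimes>\<^bsub>M\<^esub> y, x' \<otimes>\<^bsub>M\<^esub> y') \<in> r"
    and "x \<in> carrier M" "y \<in> carrier M"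
  shows "r `` {x} \<otimes>\<^bsub>quot_monoid M r\<^esub> r `` {y} = r `` {x \<otimes>\<^bsub>M\<^esub> y}"
proof -
  have "r `` {x' \<otimes>\<^bsub>M\<^esub> y'} = r `` {x \<otimes>\<^bsub>M\<^esub> y}" if "x' \<in> r `` {x}" "y' \<in> r `` {y}" for x' y'
    using assms(2)[of x x' y y'] that equiv_class_eq[OF assms(1)] by force
  moreover have "x \<in> r `` {x}" "y \<in> r `` {y}"
    using assms equiv_class_self by fastforce+
  ultimately have "(\<Union>x'\<in>r `` {x}. \<Union>y'\<in>r `` {y}. r `` {x' \<otimes>\<^bsub>M\<^esub> y'}) = r `` {x \<otimes>\<^bsub>M\<^esub> y}"
    by blast
  then show ?thesis
    by (simp add: quot_monoid_def)
qed

lemma free_monoid_simps [simp]: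
  "carrier (free_monoid B) = lists B"
  "x \<otimes>\<^bsub>free_monoid B\<^esub> y = x @ y"
  "\<one>\<^bsub>free_monoid B\<^esub> = []"
  by (simp_all add: free_monoid_def)

lemma cong_gen_words:
  assumes "(x, y) \<in> cong_gen (free_monoid B) R"
  shows "x \<in> lists B \<and> y \<in> lists B"
  using assms by induction auto

lemma equiv_cong_gen: "equiv (lists B) (cong_gen (free_monoid B) R)"
  by (intro equivI) (auto simp: refl_on_def sym_def trans_def
      dest: cong_gen_words intro: cong_gen.intros)

lemma cong_gen_append:
  assumes "(x, x') \<in> cong_gen (free_monoid B) R" "(y, y') \<in> cong_gen (free_monoid B) R"
  shows "(x @ y, x' @ y') \<in> cong_gen (free_monoid B) R"
  using cong_gen.mult[OF assms] by simp

lemma presented_monoid_carrier: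
  "carrier (presented_monoid P) = lists (gens P) // cong_gen (free_monoid (gens P)) (rels P)"
  by (simp add: presented_monoid_def)

lemma presented_monoid_mult:
  assumes "u \<in> lists (gens P)" "w \<in> lists (gens P)"
  defines "C \<equiv> cong_gen (free_monoid (gens P)) (rels P)"
  shows "C `` {u} \<otimes>\<^bsub>presented_monoid P\<^esub> C `` {w} = C `` {u @ w}"
proof -
  have "C `` {u} \<otimes>\<^bsub>presented_monoid P\<^esub> C `` {w} = C `` {u \<otimes>\<^bsub>free_monoid (gens P)\<^esub> w}"
    unfolding presented_monoid_def C_def
    by (rule quot_monoid_mult) (simp_all add: assms(1,2) equiv_cong_gen cong_gen_append)
  then show ?thesis by simp
qed

text \<open>Replaces an isomorphism on congruence classes by an evaluation of words with the right
  kernel; \<open>presented_monoid_isoE\<close> goes the other way.\<close>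

lemma presented_monoid_isoI:
  assumes f: "\<And>w. w \<in> lists (gens P) \<Longrightarrow> f w \<in> carrier M"
    and onto: "\<And>g. g \<in> carrier M \<Longrightarrow> \<exists>w\<in>lists (gens P). f w = g"
    and mult: "\<And>u w. u \<in> lists (gens P) \<Longrightarrow> w \<in> lists (gens P) \<Longrightarrow> f (u @ w) = f u \<otimes>\<^bsub>M\<^esub> f w"
    and ker: "\<And>u w. u \<in> lists (gens P) \<Longrightarrow> w \<in> lists (gens P) \<Longrightarrow>
      f u = f w \<longleftrightarrow> (u, w) \<in> cong_gen (free_monoid (gens P)) (rels P)"
  shows "presented_monoid P \<cong> M"
proof -
  let ?A = "lists (gens P)" and ?C = "cong_gen (free_monoid (gens P)) (rels P)"
  \<comment> \<open>\<open>f\<close> is constant on a congruence class, so its image there is a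
    singleton.\<close>
  define h where "h X = the_elem (f ` X)" for X
  have h: "h (?C `` {w}) = f w" if "w \<in> ?A" for w
  proof -
    have "f x = f w" if "x \<in> ?C `` {w}" for x
      using ker[of w x] \<open>w \<in> ?A\<close> that cong_gen_words[of w x] by auto
    moreover have "w \<in> ?C `` {w}"
      using that cong_gen.refl[of w "free_monoid (gens P)"] by simp
    ultimately have "f ` (?C `` {w}) = {f w}"
      by blast
    then show ?thesis by (simp add: h_def)
  qed
  have "h \<in> hom (presented_monoid P) M"
  proof (rule homI)
    fix X Y assume "X \<in> carrier (presented_monoid P)" "Y \<in> carrier (presented_monoid P)"
    then obtain u w where "u \<in> ?A" "X = ?C `` {u}" "w \<in> ?A" "Y = ?C `` {w}"
      by (auto simp: presented_monoid_carrier elim!: quotientE)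
    then show "h (X \<otimes>\<^bsub>presented_monoid P\<^esub> Y) = h X \<otimes>\<^bsub>M\<^esub> h Y"
      using presented_monoid_mult[of u P w] by (simp add: h mult)
  qed (auto simp: presented_monoid_carrier h f elim!: quotientE)
  moreover have "inj_on h (carrier (presented_monoid P))"
  proof (rule inj_onI)
    fix X Y assume "X \<in> carrier (presented_monoid P)" "Y \<in> carrier (presented_monoid P)" "h X = h Y"
    then obtain u w where *: "u \<in> ?A" "X = ?C `` {u}" "w \<in> ?A" "Y = ?C `` {w}"
      by (auto simp: presented_monoid_carrier elim!: quotientE)
    with \<open>h X = h Y\<close> have "(u, w) \<in> ?C"
      using h ker by simp
    with * show "X = Y"
      using equiv_class_eq[OF equiv_cong_gen] by simp
  qed
  moreover have "h ` carrier (presented_monoid P) = carrier M"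
  proof -
    have "g \<in> h ` (?A // ?C)" if "g \<in> carrier M" for g
      using onto[OF that] h by (metis image_eqI quotientI)
    then show ?thesis
      by (auto simp: presented_monoid_carrier h f elim!: quotientE)
  qed
  ultimately show ?thesis
    by (auto simp: is_iso_def iso_def bij_betw_def)
qed

lemma presented_monoid_isoE:
  assumes "presented_monoid P \<cong> S" "monoid S"
  obtains v where "\<And>w. w \<in> lists (gens P) \<Longrightarrow> v w \<in> carrier S"
    and "\<And>s. s \<in> carrier S \<Longrightarrow> \<exists>w\<in>lists (gens P). v w = s"
    and "v [] = \<one>\<^bsub>S\<^esub>"
    and "\<And>u w. u \<in> lists (gens P) \<Longrightarrow> w \<in> lists (gens P) \<Longrightarrow> v (u @ w) = v u \<otimes>\<^bsub>S\<^esub> v w"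
    and "\<And>u w. u \<in> lists (gens P) \<Longrightarrow> w \<in> lists (gens P) \<Longrightarrow>
      v u = v w \<longleftrightarrow> (u, w) \<in> cong_gen (free_monoid (gens P)) (rels P)"
proof -
  let ?A = "lists (gens P)" and ?C = "cong_gen (free_monoid (gens P)) (rels P)"
  interpret monoid S by fact
  obtain h where h: "h \<in> hom (presented_monoid P) S"
      "bij_betw h (carrier (presented_monoid P)) (carrier S)"
    using assms by (auto simp: is_iso_def iso_def)
  define v where "v w = h (?C `` {w})" for w
  have cls: "?C `` {w} \<in> carrier (presented_monoid P)" if "w \<in> ?A" for w
    using that by (auto simp: presented_monoid_carrier intro: quotientI)
  have closed: "v w \<in> carrier S" if "w \<in> ?A" for w
    using h(2) cls[OF that] by (auto simp: v_def bij_betw_def)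
  have onto: "\<exists>w\<in>?A. v w = s" if "s \<in> carrier S" for s
  proof -
    obtain X where "X \<in> carrier (presented_monoid P)" "h X = s"
      using bij_betw_imp_surj_on[OF h(2)] \<open>s \<in> carrier S\<close> by (metis imageE)
    then show ?thesis
      by (auto simp: presented_monoid_carrier v_def elim!: quotientE)
  qed
  have mult: "v (u @ w) = v u \<otimes>\<^bsub>S\<^esub> v w" if "u \<in> ?A" "w \<in> ?A" for u w
    using hom_mult[OF h(1) cls[OF that(1)] cls[OF that(2)]] presented_monoid_mult[OF that]
    by (simp add: v_def)
  have ker: "v u = v w \<longleftrightarrow> (u, w) \<in> ?C" if "u \<in> ?A" "w \<in> ?A" for u w
    using inj_on_eq_iff[OF bij_betw_imp_inj_on[OF h(2)] cls cls] that
      eq_equiv_class_iff[OF equiv_cong_gen] by (simp add: v_def)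
  \<comment> \<open>An isomorphism is only known to be multiplicative here, so \<open>v []\<close>
    is identified by multiplying it with a word of value one.\<close>
  obtain w where "w \<in> ?A" "v w = \<one>\<^bsub>S\<^esub>"
    using onto by blast
  then have "v [] = \<one>\<^bsub>S\<^esub>"
    using mult[of "[]" w] closed[of "[]"] by simp
  with closed onto mult ker show thesis
    by (intro that)
qed

context squier
begin

text \<open>Together with \<open>path_imp_cong_gen\<close>, identifies the components of the
  derivation graph with the congruence classes. For a product, the derivations are carried out in
  the two factors one after the other.\<close>

lemma cong_gen_imp_path:
  assumes "(u, w) \<in> cong_gen (free_monoid (gens P)) (rels P)"
  shows "\<exists>p. path_betw K u p w"
  using assms
proof induction
  case (base x y)
  then have "path_betw K x [Edge [] (x, y) True []] y"
    by auto
  then show ?case by blast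
next
  case (refl x)
  then have "path_betw K x [] x" by simp
  then show ?case by blast
next
  case (sym x y)
  then show ?case using path_inv by blast
next
  case (trans x y z)
  then show ?case using path_append by blast
next
  case (mult x y x' y')
  then obtain p q where "path_betw K x p y" "path_betw K x' q y'"
    by blast
  then have "path_betw K (x @ x') (act [] p x' @ act y q []) (y @ y')"
    using path_words by (blast intro: path_append[OF path_ract path_lact])
  then show ?case by auto
qed

lemma path_imp_cong_gen:
  assumes "path_betw K u p w"
  shows "(u, w) \<in> cong_gen (free_monoid (gens P)) (rels P)"
  using assms
proof (induction p arbitrary: u)
  case Nil
  then show ?case
    by (auto intro: cong_gen.refl)
next
  case (Cons e p)
  obtain \<alpha> r \<epsilon> \<beta> where e: "e = Edge \<alpha> r \<epsilon> \<beta>"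
    by (cases e)
  let ?C = "cong_gen (free_monoid (gens P)) (rels P)"
  have words: "\<alpha> \<in> A" "\<beta> \<in> A" "r \<in> rels P"
    using Cons.prems e by auto
  then have "(fst r, snd r) \<in> ?C"
    using rels_in_words[of "fst r" "snd r"] by (intro cong_gen.base) auto
  then have "(side r \<epsilon>, side r (\<not> \<epsilon>)) \<in> ?C"
    by (cases \<epsilon>) (auto intro: cong_gen.sym)
  then have "(\<alpha> @ side r \<epsilon> @ \<beta>, \<alpha> @ side r (\<not> \<epsilon>) @ \<beta>) \<in> ?C"
    using words by (intro cong_gen_append) (auto intro: cong_gen.refl)
  moreover have "(\<alpha> @ side r (\<not> \<epsilon>) @ \<beta>, w) \<in> ?C"
    using Cons e by auto
  ultimately have "(\<alpha> @ side r \<epsilon> @ \<beta>, w) \<in> ?C"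
    by (rule cong_gen.trans)
  then show ?case
    using Cons.prems e by auto
qed

end

section \<open>Green's relations and the Schuetzenberger group\<close>

context monoid
begin

lemma green_L_iff: "(x, y) \<in> green_L G \<longleftrightarrow> x \<in> carrier G \<and> y \<in> carrier G \<and>
    (\<exists>s\<in>carrier G. x = s \<otimes> y) \<and> (\<exists>s\<in>carrier G. y = s \<otimes> x)"
proof
  assume *: "(x, y) \<in> green_L G"
  then have c: "x \<in> carrier G" "y \<in> carrier G" and eq: "carrier G #> x = carrier G #> y"
    by (simp_all add: green_L_def)
  have "\<one> \<otimes> x \<in> carrier G #> x" "\<one> \<otimes> y \<in> carrier G #> y"
    unfolding r_coset_def by blast+
  then have "x \<in> carrier G #> y" "y \<in> carrier G #> x"
    using c eq by simp_all
  then show "x \<in> carrier G \<and> y \<in> carrier G \<and>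
      (\<exists>s\<in>carrier G. x = s \<otimes> y) \<and> (\<exists>s\<in>carrier G. y = s \<otimes> x)"
    using c unfolding r_coset_def by blast
next
  assume "x \<in> carrier G \<and> y \<in> carrier G \<and>
      (\<exists>s\<in>carrier G. x = s \<otimes> y) \<and> (\<exists>s\<in>carrier G. y = s \<otimes> x)"
  then obtain s t where *: "x \<in> carrier G" "y \<in> carrier G" "s \<in> carrier G" "t \<in> carrier G"
    "x = s \<otimes> y" "y = t \<otimes> x"
    by blast
  have "\<exists>v\<in>carrier G. u \<otimes> x = v \<otimes> y" "\<exists>v\<in>carrier G. u \<otimes> y = v \<otimes> x" if "u \<in> carrier G" for u
    using m_assoc[of u s y] m_assoc[of u t x] m_closed[of u] that * by metis+
  then show "(x, y) \<in> green_L G"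
    using *(1,2) by (simp add: green_L_def r_coset_def) blast
qed

lemma green_R_iff: "(x, y) \<in> green_R G \<longleftrightarrow> x \<in> carrier G \<and> y \<in> carrier G \<and>
    (\<exists>s\<in>carrier G. x = y \<otimes> s) \<and> (\<exists>s\<in>carrier G. y = x \<otimes> s)"
proof
  assume *: "(x, y) \<in> green_R G"
  then have c: "x \<in> carrier G" "y \<in> carrier G" and eq: "x <# carrier G = y <# carrier G"
    by (simp_all add: green_R_def)
  have "x \<otimes> \<one> \<in> x <# carrier G" "y \<otimes> \<one> \<in> y <# carrier G"
    unfolding l_coset_def by blast+
  then have "x \<in> y <# carrier G" "y \<in> x <# carrier G"
    using c eq by simp_all
  then show "x \<in> carrier G \<and> y \<in> carrier G \<and>
      (\<exists>s\<in>carrier G. x = y \<otimes> s) \<and> (\<exists>s\<in>carrier G. y = x \<otimes> s)"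
    using c unfolding l_coset_def by blast
next
  assume "x \<in> carrier G \<and> y \<in> carrier G \<and>
      (\<exists>s\<in>carrier G. x = y \<otimes> s) \<and> (\<exists>s\<in>carrier G. y = x \<otimes> s)"
  then obtain s t where *: "x \<in> carrier G" "y \<in> carrier G" "s \<in> carrier G" "t \<in> carrier G"
    "x = y \<otimes> s" "y = x \<otimes> t"
    by blast
  have "\<exists>v\<in>carrier G. x \<otimes> u = y \<otimes> v" "\<exists>v\<in>carrier G. y \<otimes> u = x \<otimes> v" if "u \<in> carrier G" for u
    using m_assoc[of y s u] m_assoc[of x t u] m_closed[of _ u] that * by metis+
  then show "(x, y) \<in> green_R G"
    using *(1,2) by (simp add: green_R_def l_coset_def) blast
qed

lemma green_L_factor: "(x, y) \<in> green_L G \<Longrightarrow> \<exists>s\<in>carrier G. y = s \<otimes> x"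
  by (simp add: green_L_iff)

lemma green_R_factor: "(x, y) \<in> green_R G \<Longrightarrow> \<exists>s\<in>carrier G. y = x \<otimes> s"
  by (simp add: green_R_iff)

lemma green_L_carrier: "(x, y) \<in> green_L G \<Longrightarrow> x \<in> carrier G \<and> y \<in> carrier G"
  by (simp add: green_L_def)

lemma green_H_carrier: "(x, y) \<in> green_H G \<Longrightarrow> x \<in> carrier G \<and> y \<in> carrier G"
  by (simp add: green_H_def green_L_def)

lemma green_L_refl: "x \<in> carrier G \<Longrightarrow> (x, x) \<in> green_L G"
  by (simp add: green_L_def)

lemma green_L_sym: "(x, y) \<in> green_L G \<Longrightarrow> (y, x) \<in> green_L G"
  by (simp add: green_L_def)

lemma green_L_trans: "(x, y) \<in> green_L G \<Longrightarrow> (y, z) \<in> green_L G \<Longrightarrow> (x, z) \<in> green_L G"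
  by (simp add: green_L_def)

lemma green_H_refl: "x \<in> carrier G \<Longrightarrow> (x, x) \<in> green_H G"
  by (simp add: green_H_def green_L_def green_R_def)

lemma green_H_sym: "(x, y) \<in> green_H G \<Longrightarrow> (y, x) \<in> green_H G"
  by (simp add: green_H_def green_L_def green_R_def)

lemma green_H_trans: "(x, y) \<in> green_H G \<Longrightarrow> (y, z) \<in> green_H G \<Longrightarrow> (x, z) \<in> green_H G"
  by (simp add: green_H_def green_L_def green_R_def)

lemma equiv_green_H: "equiv (carrier G) (green_H G)"
  by (intro equivI refl_onI symI transI)
     (auto dest: green_H_carrier intro: green_H_refl green_H_sym green_H_trans)

lemma green_L_mult:
  assumes "(x, y) \<in> green_L G" "s \<in> carrier G"
  shows "(x \<otimes> s, y \<otimes> s) \<in> green_L G"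
proof -
  have "\<exists>t\<in>carrier G. v \<otimes> s = t \<otimes> (u \<otimes> s)" if "(u, v) \<in> green_L G" for u v
    using green_L_factor[OF that] green_L_carrier[OF that] assms(2) m_assoc by metis
  then show ?thesis
    using assms green_L_sym green_L_carrier unfolding green_L_iff[of "x \<otimes> s"] by simp
qed

lemma green_R_mult:
  assumes "(x, y) \<in> green_R G" "s \<in> carrier G"
  shows "(s \<otimes> x, s \<otimes> y) \<in> green_R G"
proof -
  have "\<exists>t\<in>carrier G. s \<otimes> v = s \<otimes> u \<otimes> t" if "(u, v) \<in> green_R G" for u v
    using green_R_factor[OF that] green_R_iff[of u v] that assms(2) m_assoc by metis
  then show ?thesis
    using assms unfolding green_R_iff[of "s \<otimes> x"] by (simp add: green_R_def)
qed

text \<open>Writing \<open>x' = t \<otimes> x\<close>, left multiplication by \<open>t\<close>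
  preserves the R-relation, and right multiplication by \<open>y\<close> and \<open>z\<close>
  supplies the L-relation. So only the L-class of \<open>x\<close> matters.\<close>

lemma green_H_transport:
  assumes "(x, x') \<in> green_L G" "y \<in> carrier G" "z \<in> carrier G" "(x \<otimes> y, x \<otimes> z) \<in> green_H G"
  shows "(x' \<otimes> y, x' \<otimes> z) \<in> green_H G"
proof -
  obtain t where t: "t \<in> carrier G" "x' = t \<otimes> x" "x \<in> carrier G"
    using green_L_factor[OF assms(1)] green_L_carrier[OF assms(1)] by blast
  have "(t \<otimes> (x \<otimes> y), t \<otimes> (x \<otimes> z)) \<in> green_R G"
    using assms t by (simp add: green_H_def green_R_mult[of "x \<otimes> y"])
  then have "(x' \<otimes> y, x' \<otimes> z) \<in> green_R G"
    using assms t by (simp add: m_assoc)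
  moreover have "(x' \<otimes> y, x' \<otimes> z) \<in> green_L G"
    using green_L_mult[OF assms(1)] assms(2-4) unfolding green_H_def
    by (blast intro: green_L_sym green_L_trans)
  ultimately show ?thesis
    by (simp add: green_H_def)
qed

lemma green_H_transport_iff:
  assumes "(x, x') \<in> green_L G" "y \<in> carrier G" "z \<in> carrier G"
  shows "(x \<otimes> y, x \<otimes> z) \<in> green_H G \<longleftrightarrow> (x' \<otimes> y, x' \<otimes> z) \<in> green_H G"
  using green_H_transport assms green_L_sym by blast

end

section \<open>The stabiliser of an H-class acting on the surrounding L-class\<close>

locale h_class = monoid S for S (structure) +
  fixes H
  assumes H: "H \<in> carrier S // green_H S"
begin

lemma H_nonempty: "\<exists>h. h \<in> H"
  using H equiv_class_self[OF equiv_green_H] by (auto elim!: quotientE)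

lemma H_iff: "x \<in> H \<Longrightarrow> y \<in> H \<longleftrightarrow> (x, y) \<in> green_H S"
  using H by (auto elim!: quotientE intro: green_H_sym green_H_trans)

lemma H_carrier: "x \<in> H \<Longrightarrow> x \<in> carrier S"
  using H by (auto elim!: quotientE dest: green_H_carrier)

definition L_class where "L_class = {x. \<exists>h\<in>H. (h, x) \<in> green_L S}"

lemma L_class_carrier: "x \<in> L_class \<Longrightarrow> x \<in> carrier S"
  by (auto simp: L_class_def green_L_def)

lemma H_subset_L_class: "x \<in> H \<Longrightarrow> x \<in> L_class"
  using H_carrier green_L_refl by (auto simp: L_class_def)

lemma L_class_iff: "x \<in> L_class \<Longrightarrow> y \<in> L_class \<longleftrightarrow> (x, y) \<in> green_L S"
proof -
  assume "x \<in> L_class"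
  then obtain h where h: "h \<in> H" "(h, x) \<in> green_L S"
    by (auto simp: L_class_def)
  have "(h, k) \<in> green_L S" if "k \<in> H" for k
    using H_iff[OF h(1)] that by (simp add: green_H_def)
  then show ?thesis
    using h unfolding L_class_def by (blast intro: green_L_sym green_L_trans)
qed

abbreviation Stab where "Stab \<equiv> right_stab S H"

abbreviation \<sigma> where "\<sigma> \<equiv> schutz_cong S H"

lemma Stab_carrier: "s \<in> Stab \<Longrightarrow> s \<in> carrier S"
  by (simp add: right_stab_def)

lemma H_Stab: "x \<in> H \<Longrightarrow> s \<in> Stab \<Longrightarrow> x \<otimes> s \<in> H"
  by (auto simp: right_stab_def r_coset_def)

lemma Stab_one: "\<one> \<in> Stab"
  using H_carrier by (force simp: right_stab_def r_coset_def)

lemma L_class_mult: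
  assumes "p \<in> L_class" "s \<in> carrier S" "(p, p \<otimes> s) \<in> green_H S" "k \<in> L_class"
  shows "(k, k \<otimes> s) \<in> green_H S"
  using green_H_transport[of p k \<one> s] assms L_class_carrier L_class_iff[of p k] by simp

text \<open>A local test in the manner of Green's lemma. The relation at \<open>p\<close> transports
  to every element of \<open>H\<close>, so \<open>s\<close> maps \<open>H\<close> into itself. If
  \<open>t\<close> undoes \<open>s\<close> on \<open>p\<close>, then \<open>k \<otimes> t\<close> is
  a preimage of \<open>k\<close> in \<open>H\<close>.\<close>

lemma StabI:
  assumes "p \<in> L_class" "s \<in> carrier S" "(p, p \<otimes> s) \<in> green_H S"
  shows "s \<in> Stab"
proof -
  note p = L_class_carrier[OF assms(1)]
  obtain t where t: "t \<in> carrier S" "p = p \<otimes> s \<otimes> t"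
    using assms(3) green_R_iff unfolding green_H_def by blast
  have q: "p \<otimes> s \<in> L_class"
    using assms L_class_iff[of p "p \<otimes> s"] by (simp add: green_H_def)
  have "k \<otimes> s \<in> H" if "k \<in> H" for k
    using L_class_mult[OF assms H_subset_L_class[OF that]] H_iff[OF that] by simp
  moreover have "\<exists>k'\<in>H. k = k' \<otimes> s" if k: "k \<in> H" for k
  proof -
    obtain c where c: "c \<in> carrier S" "k = c \<otimes> (p \<otimes> s)"
      using q H_subset_L_class[OF k] L_class_iff green_L_factor by blast
    have "(k, k \<otimes> t) \<in> green_H S"
      using L_class_mult[OF q t(1) _ H_subset_L_class[OF k]] t(2) green_H_sym[OF assms(3)] by simp
    moreover have "k = k \<otimes> t \<otimes> s"
      using c t p assms(2) by (metis m_assoc m_closed)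
    ultimately show ?thesis
      using H_iff[OF k] k by blast
  qed
  ultimately show ?thesis
    using assms(2) by (auto simp: right_stab_def r_coset_def)
qed

lemma L_class_Stab:
  assumes "p \<in> L_class" "s \<in> Stab"
  shows "(p, p \<otimes> s) \<in> green_H S" "p \<otimes> s \<in> L_class"
proof -
  obtain h where h: "h \<in> H" using H_nonempty by blast
  show *: "(p, p \<otimes> s) \<in> green_H S"
    using L_class_mult[OF H_subset_L_class[OF h] Stab_carrier[OF assms(2)] _ assms(1)] H_iff[OF h]
      H_Stab[OF h assms(2)] by simp
  show "p \<otimes> s \<in> L_class"
    using * L_class_iff[OF assms(1)] by (simp add: green_H_def)
qed

lemma Stab_mult:
  assumes "s \<in> Stab" "t \<in> Stab"
  shows "s \<otimes> t \<in> Stab"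
proof -
  obtain h where h: "h \<in> H" using H_nonempty by blast
  have "h \<otimes> (s \<otimes> t) \<in> H"
    using H_Stab[OF H_Stab[OF h assms(1)] assms(2)] h assms H_carrier Stab_carrier by (simp add: m_assoc)
  then show ?thesis
    using StabI[OF H_subset_L_class[OF h], of "s \<otimes> t"] assms Stab_carrier H_iff[OF h] by simp
qed

lemma Stab_exists:
  assumes "p \<in> L_class" "(p, q) \<in> green_H S"
  shows "\<exists>s. s \<in> Stab \<and> p \<otimes> s = q"
  using assms StabI green_R_factor[of p q] unfolding green_H_def by blast

text \<open>The group acts freely on the L-class: any \<open>y\<close> there is
  \<open>c \<otimes> x\<close>, so left multiplication by \<open>c\<close> carries an equality at
  one point to all points.\<close>

lemma schutz_cong_iff:
  assumes "p \<in> L_class" "s \<in> Stab" "t \<in> Stab"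
  shows "(s, t) \<in> \<sigma> \<longleftrightarrow> p \<otimes> s = p \<otimes> t"
proof -
  have *: "y \<otimes> s = y \<otimes> t" if "x \<in> L_class" "y \<in> L_class" "x \<otimes> s = x \<otimes> t" for x y
  proof -
    have "\<exists>c\<in>carrier S. y = c \<otimes> x"
      using L_class_iff[OF that(1)] that(2) green_L_factor by blast
    with that show ?thesis
      using assms L_class_carrier Stab_carrier by (auto simp: m_assoc)
  qed
  show ?thesis
    using * H_subset_L_class H_nonempty assms unfolding schutz_cong_def by blast
qed

lemma equiv_schutz_cong: "equiv Stab \<sigma>"
  by (intro equivI) (auto simp: schutz_cong_def refl_on_def sym_def trans_def)

lemma schutz_cong_mult:
  assumes "(s, s') \<in> \<sigma>" "(t, t') \<in> \<sigma>"
  shows "(s \<otimes> t, s' \<otimes> t') \<in> \<sigma>"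
proof -
  have "x \<otimes> (s \<otimes> t) = x \<otimes> (s' \<otimes> t')" if "x \<in> H" for x
    using assms that H_Stab H_carrier Stab_carrier by (auto simp: schutz_cong_def m_assoc[symmetric])
  then show ?thesis
    using assms Stab_mult by (auto simp: schutz_cong_def)
qed

text \<open>The chosen right factor for a type of cut. Preferring \<open>\<one>\<close> makes the
  correction trivial whenever \<open>y\<close> keeps \<open>x\<close> in its H-class.\<close>

definition rep where
  "rep x y = (let T = {z \<in> carrier S. (x \<otimes> z, x \<otimes> y) \<in> green_H S} in
    if \<one> \<in> T then \<one> else SOME z. z \<in> T)"

lemma rep:
  assumes "x \<in> carrier S" "y \<in> carrier S"
  shows "rep x y \<in> carrier S" "(x \<otimes> rep x y, x \<otimes> y) \<in> green_H S"
proof -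
  have "rep x y \<in> {z \<in> carrier S. (x \<otimes> z, x \<otimes> y) \<in> green_H S}"
    unfolding rep_def Let_def using assms green_H_refl[of "x \<otimes> y"]
    by (auto split: if_split intro: someI2[where a = y])
  then show "rep x y \<in> carrier S" "(x \<otimes> rep x y, x \<otimes> y) \<in> green_H S"
    by auto
qed

lemma rep_eq_one:
  assumes "x \<in> carrier S" "(x, x \<otimes> y) \<in> green_H S"
  shows "rep x y = \<one>"
  using assms by (simp add: rep_def)

text \<open>By transport the two sets of candidates coincide, so the choice is literally the
  same.\<close>

lemma rep_cong:
  assumes "(x, x') \<in> green_L S" "y \<in> carrier S" "y' \<in> carrier S" "(x \<otimes> y, x \<otimes> y') \<in> green_H S"
  shows "rep x y = rep x' y'"
proof -
  have "(x \<otimes> z, x \<otimes> y) \<in> green_H S \<longleftrightarrow> (x' \<otimes> z, x' \<otimes> y') \<in> green_H S" if "z \<in> carrier S" for z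
    using green_H_transport_iff[OF assms(1) that assms(3)] assms(4) green_H_sym green_H_trans
    by blast
  then have "{z \<in> carrier S. (x \<otimes> z, x \<otimes> y) \<in> green_H S} = {z \<in> carrier S. (x' \<otimes> z, x' \<otimes> y') \<in> green_H S}"
    by blast
  then show ?thesis
    by (simp add: rep_def)
qed

text \<open>\<open>lab x a y\<close> compares the normal forms of the factorisations \<open>x \<cdot> ay\<close> and
  \<open>xa \<cdot> y\<close> of the same element: it is the group element picked up by moving the cut past \<open>a\<close>.\<close>

definition lab where
  "lab x a y = (SOME s. s \<in> Stab \<and> x \<otimes> rep x (a \<otimes> y) \<otimes> s = x \<otimes> a \<otimes> rep (x \<otimes> a) y)"

lemma lab:
  assumes "x \<in> carrier S" "a \<in> carrier S" "y \<in> carrier S" "x \<otimes> a \<otimes> y \<in> L_class"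
  shows "lab x a y \<in> Stab" "x \<otimes> rep x (a \<otimes> y) \<otimes> lab x a y = x \<otimes> a \<otimes> rep (x \<otimes> a) y"
proof -
  have "(x \<otimes> a \<otimes> y, x \<otimes> rep x (a \<otimes> y)) \<in> green_H S"
    using rep(2)[of x "a \<otimes> y"] assms green_H_sym by (simp add: m_assoc)
  moreover have "(x \<otimes> a \<otimes> y, x \<otimes> a \<otimes> rep (x \<otimes> a) y) \<in> green_H S"
    using rep(2)[of "x \<otimes> a" y] assms green_H_sym by simp
  ultimately have "x \<otimes> rep x (a \<otimes> y) \<in> L_class"
    "(x \<otimes> rep x (a \<otimes> y), x \<otimes> a \<otimes> rep (x \<otimes> a) y) \<in> green_H S"
    using L_class_iff[OF assms(4)] by (auto simp: green_H_def green_L_def green_R_def)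
  then have "\<exists>s. s \<in> Stab \<and> x \<otimes> rep x (a \<otimes> y) \<otimes> s = x \<otimes> a \<otimes> rep (x \<otimes> a) y"
    by (rule Stab_exists)
  from someI_ex[OF this] show "lab x a y \<in> Stab"
    "x \<otimes> rep x (a \<otimes> y) \<otimes> lab x a y = x \<otimes> a \<otimes> rep (x \<otimes> a) y"
    by (simp_all add: lab_def)
qed

lemma lab_cong:
  assumes "(x, x') \<in> green_L S" "a \<in> carrier S" "y \<in> carrier S" "y' \<in> carrier S"
    and "(x \<otimes> a \<otimes> y, x \<otimes> a \<otimes> y') \<in> green_H S"
  shows "lab x a y = lab x' a y'"
proof -
  note x = green_L_carrier[OF assms(1)]
  have r: "rep x (a \<otimes> y) = rep x' (a \<otimes> y')"
    using assms x by (intro rep_cong) (auto simp: m_assoc)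
  have r': "rep (x \<otimes> a) y = rep (x' \<otimes> a) y'"
    using assms green_L_mult by (intro rep_cong) auto
  \<comment> \<open>The left factors relating \<open>x\<close> and \<open>x'\<close> carry equations
    both ways, so both labels are chosen by the same condition.\<close>
  have "x \<otimes> u = x \<otimes> w \<longleftrightarrow> x' \<otimes> u = x' \<otimes> w" if "u \<in> carrier S" "w \<in> carrier S" for u w
    using green_L_factor[OF assms(1)] green_L_factor[OF green_L_sym[OF assms(1)]] x that
    by (metis m_assoc)
  then have "x \<otimes> rep x (a \<otimes> y) \<otimes> s = x \<otimes> a \<otimes> rep (x \<otimes> a) y \<longleftrightarrow>
      x' \<otimes> rep x (a \<otimes> y) \<otimes> s = x' \<otimes> a \<otimes> rep (x \<otimes> a) y" if "s \<in> Stab" for s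
    using x assms Stab_carrier[OF that] rep(1)[of x "a \<otimes> y"] rep(1)[of "x \<otimes> a" y] by (simp add: m_assoc)
  then show ?thesis
    unfolding lab_def r[symmetric] r'[symmetric] by (simp cong: conj_cong)
qed

text \<open>Finitely many one-sided ideals leave finitely many L- and R-classes. By
  \<open>cong\<close>, \<open>f\<close> depends only on the L-class of \<open>x\<close> and, once
  \<open>x\<close> is replaced by a fixed member of that class, on the H-class of the
  product.\<close>

lemma finite_contexts:
  assumes "finite {I. left_ideal S I}" "finite {I. right_ideal S I}" and s: "s \<in> carrier S"
    and cong: "\<And>x x' y y'. (x, x') \<in> green_L S \<Longrightarrow> y \<in> carrier S \<Longrightarrow> y' \<in> carrier S \<Longrightarrow>
      x \<otimes> s \<otimes> y \<in> L_class \<Longrightarrow> (x \<otimes> s \<otimes> y, x \<otimes> s \<otimes> y') \<in> green_H S \<Longrightarrow> f x y = f x' y'"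
  shows "finite {f x y | x y. x \<in> carrier S \<and> y \<in> carrier S \<and> x \<otimes> s \<otimes> y \<in> L_class}"
proof -
  define l where "l x = carrier S #> x" for x
  define r where "r x = x <# carrier S" for x
  have "left_ideal S (l x)" if "x \<in> carrier S" for x
    using that unfolding l_def left_ideal_def r_coset_def by (auto simp: m_assoc[symmetric])
  then have "l ` carrier S \<subseteq> {I. left_ideal S I}" by blast
  with assms(1) have fin_l: "finite (l ` carrier S)"
    by (rule finite_subset[rotated])
  have "right_ideal S (r x)" if "x \<in> carrier S" for x
    using that unfolding r_def right_ideal_def l_coset_def by (auto simp: m_assoc)
  then have "r ` carrier S \<subseteq> {I. right_ideal S I}" by blast
  with assms(2) have fin_r: "finite (r ` carrier S)"
    by (rule finite_subset[rotated])
  have l: "(x, y) \<in> green_L S \<longleftrightarrow> x \<in> carrier S \<and> y \<in> carrier S \<and> l x = l y" for x y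
    by (simp add: green_L_def l_def)
  have r: "(x, y) \<in> green_R S \<longleftrightarrow> x \<in> carrier S \<and> y \<in> carrier S \<and> r x = r y" for x y
    by (simp add: green_R_def r_def)
  \<comment> \<open>A fixed member of the L-class of \<open>x\<close>: right contexts are compared
    behind the same left factor.\<close>
  define c where "c x = inv_into (carrier S) l (l x)" for x
  have c: "c x \<in> carrier S" "(x, c x) \<in> green_L S" if "x \<in> carrier S" for x
    using that inv_into_into[of "l x" l "carrier S"] f_inv_into_f[of "l x" l "carrier S"]
    by (auto simp: l c_def)
  define T where "T = {(x, y). x \<in> carrier S \<and> y \<in> carrier S \<and> x \<otimes> s \<otimes> y \<in> L_class}"
  define k where "k = (\<lambda>(x, y). (l x, l (c x \<otimes> s \<otimes> y), r (c x \<otimes> s \<otimes> y)))"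
  have "k ` T \<subseteq> l ` carrier S \<times> l ` carrier S \<times> r ` carrier S"
    using c s by (auto simp: k_def T_def)
  then have "finite (k ` T)"
    using fin_l fin_r by (meson finite_SigmaI finite_subset)
  have eq: "case_prod f p = case_prod f q" if pq: "p \<in> T" "q \<in> T" "k p = k q" for p q
  proof -
    obtain x y x' y' where xy: "p = (x, y)" "q = (x', y')" by (cases p, cases q)
    have x: "(x, x') \<in> green_L S" "c x = c x'"
      using pq by (auto simp: xy T_def k_def l c_def)
    have "(c x \<otimes> (s \<otimes> y), c x \<otimes> (s \<otimes> y')) \<in> green_H S"
      using pq c(1)[of x] s x by (auto simp: green_H_def xy T_def k_def l r m_assoc)
    then have "(x \<otimes> (s \<otimes> y), x \<otimes> (s \<otimes> y')) \<in> green_H S"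
      using pq c[of x] s by (subst green_H_transport_iff[of x "c x"]) (auto simp: xy T_def)
    then show ?thesis
      using cong[OF x(1), of y y'] pq s by (auto simp: xy T_def m_assoc)
  qed
  \<comment> \<open>\<open>case_prod f\<close> factors through the key \<open>k\<close>, which has
    finitely many values.\<close>
  have "case_prod f ` T \<subseteq> (\<lambda>a. case_prod f (inv_into T k a)) ` (k ` T)"
  proof (rule image_subsetI)
    fix p assume "p \<in> T"
    then have "case_prod f p = case_prod f (inv_into T k (k p))"
      using eq[of p "inv_into T k (k p)"] inv_into_into[of "k p" k T] f_inv_into_f[of "k p" k T] by simp
    with \<open>p \<in> T\<close> show "case_prod f p \<in> (\<lambda>a. case_prod f (inv_into T k a)) ` (k ` T)"
      by blast
  qed
  with \<open>finite (k ` T)\<close> have "finite (case_prod f ` T)"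
    by (meson finite_imageI finite_subset)
  moreover have "{f x y | x y. x \<in> carrier S \<and> y \<in> carrier S \<and> x \<otimes> s \<otimes> y \<in> L_class} = case_prod f ` T"
    by (auto simp: T_def)
  ultimately show ?thesis by simp
qed

end

section \<open>Rewriting words of the monoid into words of the group\<close>

text \<open>\<open>v\<close> evaluates words of \<open>P\<close> in \<open>S\<close>, and
  \<open>enc\<close> turns labels, which are elements of \<open>S\<close>, into letters. Its
  injectivity is assumed on a written-out set because \<open>labels\<close> is defined only inside
  the locale.\<close>

locale schutz_rewriting = h_class S H + PS: squier P X
  for S :: "('a, 'm) monoid_scheme" (structure) and H and P :: "'b presentation" and X +
  fixes v :: "'b list \<Rightarrow> 'a" and enc :: "'a \<Rightarrow> 'c"
  assumes v_closed [simp]: "w \<in> lists (gens P) \<Longrightarrow> v w \<in> carrier S"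
    and v_onto: "s \<in> carrier S \<Longrightarrow> \<exists>w\<in>lists (gens P). v w = s"
    and v_Nil [simp]: "v [] = \<one>"
    and v_append [simp]: "u \<in> lists (gens P) \<Longrightarrow> w \<in> lists (gens P) \<Longrightarrow> v (u @ w) = v u \<otimes> v w"
    and v_ker: "u \<in> lists (gens P) \<Longrightarrow> w \<in> lists (gens P) \<Longrightarrow>
      v u = v w \<longleftrightarrow> (u, w) \<in> cong_gen (free_monoid (gens P)) (rels P)"
    and finite_left: "finite {I. left_ideal S I}"
    and finite_right: "finite {I. right_ideal S I}"
    and finite_gens: "finite (gens P)"
    and finite_rels: "finite (rels P)"
    and finite_X: "finite X"
    and base: "homotopy_base P X"
    and inj_enc: "inj_on enc (\<Union>a\<in>gens P. {lab x (v [a]) y | x y. x \<in> carrier S \<and> y \<in> carrier S \<and>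
      x \<otimes> v [a] \<otimes> y \<in> L_class})"
begin

definition labels where
  "labels = (\<Union>a\<in>gens P. {lab x (v [a]) y | x y. x \<in> carrier S \<and> y \<in> carrier S \<and>
    x \<otimes> v [a] \<otimes> y \<in> L_class})"

definition B where "B = enc ` labels"

definition dec where "dec = inv_into labels enc"

lemma v_Cons: "a \<in> gens P \<Longrightarrow> w \<in> PS.A \<Longrightarrow> v (a # w) = v [a] \<otimes> v w"
  using v_append[of "[a]" w] by simp

lemma v_eq_iff_path: "u \<in> PS.A \<Longrightarrow> w \<in> PS.A \<Longrightarrow> v u = v w \<longleftrightarrow> (\<exists>p. path_betw PS.K u p w)"
  using v_ker[of u w] PS.cong_gen_imp_path[of u w] PS.path_imp_cong_gen[of u _ w] by blast

lemma v_path: "path_betw PS.K u p w \<Longrightarrow> v u = v w"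
  using v_eq_iff_path[of u w] PS.path_words[of u p w] by blast

lemma v_rel: "(u, w) \<in> rels P \<Longrightarrow> v u = v w"
  using v_ker cong_gen.base[of u w "rels P" "free_monoid (gens P)"] PS.rels_in_words by simp

lemma v_arc: "e \<in> arcs (derivation_graph P) \<Longrightarrow> v (edge_source e) = v (edge_target e)"
  using v_path[of "edge_source e" "[e]" "edge_target e"] PS.arc_ends_in_words by simp

lemma htpy_closed:
  assumes "path_betw PS.K u p u"
  shows "PS.htpy u p [] u"
  using base assms PS.path_squier_iff
  unfolding homotopy_base_def closed_paths_def PS.htpy_def by blast

lemma labelsI: "a \<in> gens P \<Longrightarrow> x \<in> carrier S \<Longrightarrow> y \<in> carrier S \<Longrightarrow>
    x \<otimes> v [a] \<otimes> y \<in> L_class \<Longrightarrow> lab x (v [a]) y \<in> labels"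
  unfolding labels_def by (rule UN_I) auto

lemma finite_labels: "finite labels"
  unfolding labels_def
proof (rule finite_UN_I[OF finite_gens])
  fix a assume a: "a \<in> gens P"
  show "finite {lab x (v [a]) y | x y. x \<in> carrier S \<and> y \<in> carrier S \<and> x \<otimes> v [a] \<otimes> y \<in> L_class}"
    by (rule finite_contexts[OF finite_left finite_right]) (use a lab_cong in auto)
qed

lemma finite_B: "finite B"
  using finite_labels by (simp add: B_def)

lemma dec_enc: "s \<in> labels \<Longrightarrow> dec (enc s) = s"
  using inj_enc by (simp add: dec_def labels_def)

lemma labels_Stab: "s \<in> labels \<Longrightarrow> s \<in> Stab"
  by (auto simp: labels_def intro: lab)

lemma dec_Stab: "b \<in> B \<Longrightarrow> dec b \<in> Stab"
  by (auto simp: B_def dec_enc labels_Stab)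

primrec val :: "'c list \<Rightarrow> 'a" where
  "val [] = \<one>"
| "val (b # w) = dec b \<otimes> val w"

lemma val_Stab: "w \<in> lists B \<Longrightarrow> val w \<in> Stab"
  by (induction w) (auto simp: Stab_one Stab_mult dec_Stab)

lemma val_carrier [simp]: "w \<in> lists B \<Longrightarrow> val w \<in> carrier S"
  using val_Stab Stab_carrier by blast

lemma dec_carrier [simp]: "b \<in> B \<Longrightarrow> dec b \<in> carrier S"
  using dec_Stab Stab_carrier by blast

lemma val_append: "u \<in> lists B \<Longrightarrow> w \<in> lists B \<Longrightarrow> val (u @ w) = val u \<otimes> val w"
  by (induction u) (auto simp: m_assoc)

text \<open>Reads off the labels while the cut runs from the left end of the word to its right end,
  with outer factors \<open>x\<close> and \<open>y\<close>. At each letter the part still ahead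
  belongs to the right factor.\<close>

primrec psi :: "'a \<Rightarrow> 'b list \<Rightarrow> 'a \<Rightarrow> 'c list" where
  "psi x [] y = []"
| "psi x (a # w) y = enc (lab x (v [a]) (v w \<otimes> y)) # psi (x \<otimes> v [a]) w y"

lemma psi_append:
  assumes "u \<in> PS.A" "w \<in> PS.A" "x \<in> carrier S" "y \<in> carrier S"
  shows "psi x (u @ w) y = psi x u (v w \<otimes> y) @ psi (x \<otimes> v u) w y"
  using assms(1,3)
proof (induction u arbitrary: x)
  case (Cons a u)
  then show ?case
    using assms by (simp add: m_assoc v_Cons[of a u])
qed simp

lemma psi_words:
  assumes "w \<in> PS.A" "x \<in> carrier S" "y \<in> carrier S" "x \<otimes> v w \<otimes> y \<in> L_class"
  shows "psi x w y \<in> lists B"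
  using assms(1,2,4)
proof (induction w arbitrary: x)
  case (Cons a w)
  then have *: "a \<in> gens P" "w \<in> PS.A" "x \<otimes> v [a] \<otimes> (v w \<otimes> y) \<in> L_class"
    using assms(3) by (simp_all add: m_assoc v_Cons[of a w])
  then have "lab x (v [a]) (v w \<otimes> y) \<in> labels"
    using Cons.prems assms(3) by (intro labelsI) simp_all
  moreover have "psi (x \<otimes> v [a]) w y \<in> lists B"
    using Cons.IH[of "x \<otimes> v [a]"] * Cons.prems assms(3) by (simp add: m_assoc)
  ultimately show ?case
    by (simp add: B_def)
qed simp

lemma psi_cong:
  assumes "w \<in> PS.A" "(x, x') \<in> green_L S" "y \<in> carrier S" "y' \<in> carrier S"
    and "(x \<otimes> v w \<otimes> y, x \<otimes> v w \<otimes> y') \<in> green_H S"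
  shows "psi x w y = psi x' w y'"
  using assms(1,2,5)
proof (induction w arbitrary: x x')
  case (Cons a w)
  then have *: "a \<in> gens P" "w \<in> PS.A" "x \<in> carrier S"
    using green_L_carrier by simp_all
  then have **: "(x \<otimes> v [a] \<otimes> (v w \<otimes> y), x \<otimes> v [a] \<otimes> (v w \<otimes> y')) \<in> green_H S"
    using Cons.prems assms(3,4) by (simp add: m_assoc v_Cons[of a w])
  then have "lab x (v [a]) (v w \<otimes> y) = lab x' (v [a]) (v w \<otimes> y')"
    using * Cons.prems assms(3,4) by (intro lab_cong) simp_all
  moreover have "psi (x \<otimes> v [a]) w y = psi (x' \<otimes> v [a]) w y'"
    using * ** Cons.prems green_L_mult assms(3,4) by (intro Cons.IH) (simp_all add: m_assoc)
  ultimately show ?case by simp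
qed simp

text \<open>The equations defining the labels telescope: the representatives at intermediate cuts
  cancel and only those at the two ends remain.\<close>

lemma psi_value:
  assumes "w \<in> PS.A" "x \<in> carrier S" "y \<in> carrier S" "x \<otimes> v w \<otimes> y \<in> L_class"
  shows "x \<otimes> rep x (v w \<otimes> y) \<otimes> val (psi x w y) = x \<otimes> v w \<otimes> rep (x \<otimes> v w) y"
  using assms(1,2,4)
proof (induction w arbitrary: x)
  case Nil
  then show ?case
    using assms(3) rep(1) by simp
next
  case (Cons a w)
  let ?y = "v w \<otimes> y" and ?s = "lab x (v [a]) (v w \<otimes> y)"
  have *: "a \<in> gens P" "w \<in> PS.A" "x \<otimes> v [a] \<otimes> (v w \<otimes> y) \<in> L_class"
    using Cons.hyps Cons.prems assms(3) by (simp_all add: m_assoc v_Cons[of a w])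
  then have s: "?s \<in> labels"
    using Cons.prems assms(3) by (intro labelsI) simp_all
  have xa: "x \<otimes> v [a] \<otimes> v w \<otimes> y \<in> L_class"
    using * Cons.prems assms(3) by (simp add: m_assoc)
  have "psi (x \<otimes> v [a]) w y \<in> lists B"
    using * Cons.prems assms(3) xa by (intro psi_words) simp_all
  then have "x \<otimes> rep x (v [a] \<otimes> ?y) \<otimes> val (psi x (a # w) y) =
      x \<otimes> rep x (v [a] \<otimes> ?y) \<otimes> ?s \<otimes> val (psi (x \<otimes> v [a]) w y)"
    using s * Cons.prems assms(3) rep(1)[of x "v [a] \<otimes> ?y"] labels_Stab[OF s] Stab_carrier
    by (simp add: dec_enc m_assoc)
  also have "\<dots> = x \<otimes> v [a] \<otimes> rep (x \<otimes> v [a]) ?y \<otimes> val (psi (x \<otimes> v [a]) w y)"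
    using lab(2)[OF _ _ _ *(3)] * Cons.prems assms(3) by simp
  also have "\<dots> = x \<otimes> v [a] \<otimes> v w \<otimes> rep (x \<otimes> v [a] \<otimes> v w) y"
    using * Cons.prems xa by (intro Cons.IH) simp_all
  finally show ?case
    using * Cons.prems assms(3) by (simp add: v_Cons[of a w] m_assoc)
qed

text \<open>As \<open>h\<close> is its own normal form, no correction factor arises at the left end of a word for \<open>h\<close>.\<close>

definition h where "h = rep \<one> (SOME k. k \<in> H)"

lemma h_in_H: "h \<in> H" and rep_h: "rep \<one> h = h"
proof -
  define k where "k = (SOME k. k \<in> H)"
  have k: "k \<in> H"
    unfolding k_def using H_nonempty by (rule someI_ex)
  have *: "h \<in> carrier S" "(k, h) \<in> green_H S"
    using rep[of \<one> k] H_carrier[OF k] green_H_sym by (auto simp: h_def k_def)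
  then show "h \<in> H"
    using H_iff[OF k] by simp
  \<comment> \<open>\<open>h\<close> is H-related to \<open>k\<close>, so taking the representative
    a second time changes nothing.\<close>
  have "rep \<one> k = rep \<one> h"
    using * H_carrier[OF k] by (intro rep_cong) (auto intro: green_L_refl)
  then show "rep \<one> h = h"
    by (simp add: h_def k_def)
qed

lemma h_carrier [simp]: "h \<in> carrier S"
  using H_carrier h_in_H by blast

lemma h_L_class: "h \<in> L_class"
  using H_subset_L_class h_in_H by blast

lemma h_val_L_class: "w \<in> lists B \<Longrightarrow> h \<otimes> val w \<in> L_class"
  using L_class_Stab(2)[OF h_L_class val_Stab] .

section \<open>Lifting words over the labels, and the round trip\<close>

definition word where "word s = (SOME w. w \<in> PS.A \<and> v w = s)"

lemma word:
  assumes "s \<in> carrier S"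
  shows "word s \<in> PS.A" "v (word s) = s"
proof -
  have "\<exists>w. w \<in> PS.A \<and> v w = s"
    using v_onto[OF assms] by blast
  from someI_ex[OF this] show "word s \<in> PS.A" "v (word s) = s"
    by (simp_all add: word_def)
qed

abbreviation uh where "uh \<equiv> word h"

lemmas uh [simp] = word[OF h_carrier]

primrec phi :: "'c list \<Rightarrow> 'b list" where
  "phi [] = []"
| "phi (b # w) = word (dec b) @ phi w"

lemma phi [simp]: "w \<in> lists B \<Longrightarrow> phi w \<in> PS.A" "w \<in> lists B \<Longrightarrow> v (phi w) = val w"
proof (induction w)
  case (Cons b w)
  {
    case 1
    then show ?case using Cons word(1)[of "dec b"] by simp
  next
    case 2
    then show ?case using Cons word[of "dec b"] by simp
  }
qed simp_all

lemma phi_append: "phi (u @ w) = phi u @ phi w"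
  by (induction u) simp_all

text \<open>The round trip: lift \<open>w\<close> to a word of \<open>P\<close>, then read off
  labels behind \<open>h\<close>.\<close>

definition tau :: "'c list \<Rightarrow> 'c list" where "tau w = psi h (phi w) \<one>"

text \<open>The labels picked up while crossing the word for \<open>h\<close> when \<open>x\<close>
  stands in front.\<close>

definition zeta where "zeta x = psi x uh \<one>"

lemma psi_h_cong:
  assumes "u \<in> PS.A" "x \<in> carrier S" "x \<otimes> v u \<in> L_class" "w \<in> lists B"
  shows "psi x u (val w) = psi x u \<one>"
  using assms L_class_Stab(1)[OF assms(3) val_Stab[OF assms(4)]] green_H_sym
  by (intro psi_cong) (auto intro: green_L_refl)

text \<open>Stabiliser elements change neither the L-class of a left context nor the H-class of the
  product, so neither factor notices the other.\<close>

lemma tau_append: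
  assumes "u \<in> lists B" "w \<in> lists B"
  shows "tau (u @ w) = tau u @ tau w"
proof -
  have u: "h \<otimes> val u \<in> L_class"
    using assms(1) by (rule h_val_L_class)
  have "psi h (phi u @ phi w) \<one> = psi h (phi u) (val w) @ psi (h \<otimes> val u) (phi w) \<one>"
    using assms by (simp add: psi_append)
  also have "psi h (phi u) (val w) = psi h (phi u) \<one>"
    using assms u by (intro psi_h_cong) simp_all
  also have "psi (h \<otimes> val u) (phi w) \<one> = psi h (phi w) \<one>"
    using assms u L_class_iff[OF u] h_L_class by (intro psi_cong) (auto intro: green_H_refl)
  finally show ?thesis
    by (simp add: tau_def phi_append)
qed

lemma tau_Nil [simp]: "tau [] = []"
  by (simp add: tau_def)

lemma tau_words: "w \<in> lists B \<Longrightarrow> tau w \<in> lists B"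
  unfolding tau_def using h_val_L_class[of w] by (intro psi_words) simp_all

lemma zeta_words: "x \<in> carrier S \<Longrightarrow> x \<otimes> h \<in> L_class \<Longrightarrow> zeta x \<in> lists B"
  unfolding zeta_def by (intro psi_words) simp_all

text \<open>The image of a lifted word splits: \<open>x\<close> influences only
  \<open>zeta x\<close>, since \<open>x \<otimes> h\<close> is L-related to
  \<open>h\<close>.\<close>

lemma psi_uh_phi:
  assumes "x \<in> carrier S" "x \<otimes> h \<in> L_class" "w \<in> lists B"
  shows "psi x (uh @ phi w) \<one> = zeta x @ tau w"
proof -
  have "psi x (uh @ phi w) \<one> = psi x uh (val w) @ psi (x \<otimes> h) (phi w) \<one>"
    using assms by (simp add: psi_append)
  also have "psi x uh (val w) = zeta x"
    unfolding zeta_def using assms by (intro psi_h_cong) simp_all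
  also have "psi (x \<otimes> h) (phi w) \<one> = tau w"
    unfolding tau_def using assms L_class_iff[OF assms(2)] h_L_class
    by (intro psi_cong) (auto intro: green_H_refl)
  finally show ?thesis .
qed

text \<open>The first family consists of the images of the relations of \<open>P\<close>, so that
  \<open>psi\<close> respects derivations. The other two lead from a word \<open>w\<close> to
  \<open>tau w\<close> and on to \<open>zeta \<one> @ tau w\<close>, the image of the lift of
  \<open>w\<close> behind \<open>h\<close>.\<close>

definition PG :: "'c presentation" where
  "PG = \<lparr>gens = B, rels =
    (\<Union>(u, w)\<in>rels P. {(psi x u y, psi x w y) | x y.
      x \<in> carrier S \<and> y \<in> carrier S \<and> x \<otimes> v u \<otimes> y \<in> L_class}) \<union>
    {([], zeta \<one>)} \<union> {([b], tau [b]) | b. b \<in> B}\<rparr>"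

lemma gens_PG [simp]: "gens PG = B"
  by (simp add: PG_def)

lemma rels_PG_cases:
  assumes "(s, t) \<in> rels PG"
  obtains (old) u w x y where "(u, w) \<in> rels P" "x \<in> carrier S" "y \<in> carrier S"
      "x \<otimes> v u \<otimes> y \<in> L_class" "s = psi x u y" "t = psi x w y"
    | (unit) "s = []" "t = zeta \<one>"
    | (letter) b where "b \<in> B" "s = [b]" "t = tau [b]"
  using assms by (auto simp: PG_def)

lemma finite_rels_PG: "finite (rels PG)"
proof -
  have "finite {(psi x u y, psi x w y) | x y.
      x \<in> carrier S \<and> y \<in> carrier S \<and> x \<otimes> v u \<otimes> y \<in> L_class}" if uw: "(u, w) \<in> rels P" for u w
  proof (rule finite_contexts[OF finite_left finite_right])
    show "v u \<in> carrier S"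
      using PS.rels_in_words[OF uw] by simp
    fix x x' y y' assume *: "(x, x') \<in> green_L S" "y \<in> carrier S" "y' \<in> carrier S"
      "(x \<otimes> v u \<otimes> y, x \<otimes> v u \<otimes> y') \<in> green_H S"
    then show "(psi x u y, psi x w y) = (psi x' u y', psi x' w y')"
      using psi_cong[OF _ *(1-3)] PS.rels_in_words[OF uw] v_rel[OF uw] by simp
  qed
  then have "finite (\<Union>(u, w)\<in>rels P. {(psi x u y, psi x w y) | x y.
      x \<in> carrier S \<and> y \<in> carrier S \<and> x \<otimes> v u \<otimes> y \<in> L_class})"
    using finite_rels by (intro finite_UN_I) auto
  moreover have "finite {([b], tau [b]) | b. b \<in> B}"
    using finite_B by simp
  ultimately show ?thesis
    by (simp add: PG_def)
qed

lemma is_presentation_PG: "is_presentation PG"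
  unfolding is_presentation_def
proof (rule subrelI)
  fix s t assume "(s, t) \<in> rels PG"
  then show "(s, t) \<in> lists (gens PG) \<times> lists (gens PG)"
  proof (cases rule: rels_PG_cases)
    case (old u w x y)
    then show ?thesis
      using psi_words[of u x y] psi_words[of w x y] PS.rels_in_words[OF old(1)] v_rel[OF old(1)] by simp
  next
    case unit
    then show ?thesis
      using zeta_words h_L_class by simp
  next
    case (letter b)
    then show ?thesis
      using tau_words[of "[b]"] by simp
  qed
qed

lemma finite_presentation_PG: "finite_presentation PG"
  by (simp add: finite_presentation_def is_presentation_PG finite_B finite_rels_PG)

section \<open>Soundness of the relations in the Schuetzenberger group\<close>

lemma h_val_tau:
  assumes "w \<in> lists B"
  shows "h \<otimes> val (tau w) = h \<otimes> val w"
proof -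
  have "h \<otimes> rep h (val w) \<otimes> val (tau w) = h \<otimes> val w \<otimes> rep (h \<otimes> val w) \<one>"
    using psi_value[of "phi w" h \<one>] assms h_val_L_class[OF assms] by (simp add: tau_def)
  moreover have "rep h (val w) = \<one>" "rep (h \<otimes> val w) \<one> = \<one>"
    using assms L_class_Stab(1)[OF h_L_class val_Stab[OF assms]]
    by (auto intro!: rep_eq_one green_H_refl)
  ultimately show ?thesis
    using assms tau_words[OF assms] by simp
qed

text \<open>This rests on \<open>rep_h\<close>: at the left end of \<open>uh\<close> the normal form
  is already \<open>h\<close>, so crossing \<open>uh\<close> contributes a trivial group
  element.\<close>

lemma h_val_zeta: "h \<otimes> val (zeta \<one>) = h"
proof -
  have "rep h \<one> = \<one>"
    by (auto intro!: rep_eq_one green_H_refl)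
  then show ?thesis
    using psi_value[of uh \<one> \<one>] h_L_class rep_h by (simp add: zeta_def)
qed

lemma rels_PG_val:
  assumes "(s, t) \<in> rels PG"
  shows "(val s, val t) \<in> \<sigma>"
proof -
  have words: "s \<in> lists B" "t \<in> lists B"
    using assms is_presentation_PG by (auto simp: is_presentation_def)
  note val = val_Stab[OF words(1)] val_Stab[OF words(2)]
  show ?thesis
    using assms
  proof (cases rule: rels_PG_cases)
    case (old u w x y)
    note uw = PS.rels_in_words[OF old(1)] v_rel[OF old(1)]
    let ?p = "x \<otimes> rep x (v u \<otimes> y)"
    \<comment> \<open>As \<open>v u = v w\<close>, \<open>psi_value\<close> yields the same element
      for both words, and \<open>?p\<close> serves as test point in the L-class.\<close>
    have "?p \<otimes> val s = ?p \<otimes> val t"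
      using psi_value[of u x y] psi_value[of w x y] old uw by simp
    moreover have "(x \<otimes> v u \<otimes> y, ?p) \<in> green_H S"
      using rep(2)[of x "v u \<otimes> y"] old uw green_H_sym by (simp add: m_assoc)
    then have "?p \<in> L_class"
      using L_class_iff[OF old(4)] by (simp add: green_H_def)
    ultimately show ?thesis
      using schutz_cong_iff val by blast
  next
    case unit
    then show ?thesis
      using schutz_cong_iff[OF h_L_class val] h_val_zeta by simp
  next
    case (letter b)
    then show ?thesis
      using schutz_cong_iff[OF h_L_class val] h_val_tau[of "[b]"] by simp
  qed
qed

lemma cong_gen_val:
  assumes "(u, w) \<in> cong_gen (free_monoid B) (rels PG)"
  shows "(val u, val w) \<in> \<sigma>"
  using assms
proof induction
  case (base x y)
  then show ?case by (intro rels_PG_val)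
next
  case (refl x)
  then show ?case
    using val_Stab equiv_schutz_cong by (simp add: equiv_def refl_on_def)
next
  case (sym x y)
  then show ?case
    using equiv_schutz_cong by (meson equivE symD)
next
  case (trans x y z)
  then show ?case
    using equiv_schutz_cong by (meson equivE transD)
next
  case (mult x y x' y')
  then show ?case
    using schutz_cong_mult cong_gen_words by (simp add: val_append[of x x'] val_append[of y y'] cong_gen_words)
qed

section \<open>The induced map of Squier complexes\<close>

text \<open>All contexts use \<open>fst r\<close> whatever the sign, as both sides of a relation
  have the same value. With this choice \<open>psi_edge\<close> commutes with inversion
  unconditionally.\<close>

fun psi_edge :: "'a \<Rightarrow> 'b edge \<Rightarrow> 'a \<Rightarrow> 'c edge" where
  "psi_edge x (Edge \<gamma> r \<epsilon> \<delta>) y = Edge (psi x \<gamma> (v (fst r) \<otimes> (v \<delta> \<otimes> y)))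
    (psi (x \<otimes> v \<gamma>) (fst r) (v \<delta> \<otimes> y), psi (x \<otimes> v \<gamma>) (snd r) (v \<delta> \<otimes> y)) \<epsilon>
    (psi (x \<otimes> v \<gamma> \<otimes> v (fst r)) \<delta> y)"

definition Psi :: "'a \<Rightarrow> 'b edge list \<Rightarrow> 'a \<Rightarrow> 'c edge list" where
  "Psi x p y = map (\<lambda>e. psi_edge x e y) p"

lemma Psi_simps [simp]:
  "Psi x [] y = []"
  "Psi x (e # p) y = psi_edge x e y # Psi x p y"
  "Psi x (p @ q) y = Psi x p y @ Psi x q y"
  by (simp_all add: Psi_def)

lemma psi_edge_inv [simp]: "psi_edge x (edge_inv e) y = edge_inv (psi_edge x e y)"
  by (cases e) simp

lemma arcE:
  assumes "e \<in> arcs (derivation_graph P)"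
  obtains \<gamma> r \<epsilon> \<delta> where "e = Edge \<gamma> r \<epsilon> \<delta>" "\<gamma> \<in> PS.A" "\<delta> \<in> PS.A" "r \<in> rels P"
    "fst r \<in> PS.A" "snd r \<in> PS.A" "v (snd r) = v (fst r)"
proof -
  obtain \<gamma> r \<epsilon> \<delta> where e: "e = Edge \<gamma> r \<epsilon> \<delta>" by (cases e)
  then have "\<gamma> \<in> PS.A" "\<delta> \<in> PS.A" "r \<in> rels P"
    using assms by simp_all
  with e show thesis
    using that PS.rels_in_words[of "fst r" "snd r"] v_rel[of "fst r" "snd r"] by simp
qed

lemma v_source:
  assumes "Edge \<gamma> r \<epsilon> \<delta> \<in> arcs (derivation_graph P)"
  shows "v (edge_source (Edge \<gamma> r \<epsilon> \<delta>)) = v \<gamma> \<otimes> (v (fst r) \<otimes> v \<delta>)"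
  using assms by (elim arcE) (cases \<epsilon>; simp)

lemma psi_edge_ends:
  assumes "e \<in> arcs (derivation_graph P)" "x \<in> carrier S" "y \<in> carrier S"
  shows "edge_source (psi_edge x e y) = psi x (edge_source e) y"
    and "edge_target (psi_edge x e y) = psi x (edge_target e) y"
proof -
  obtain \<gamma> r \<epsilon> \<delta> where e: "e = Edge \<gamma> r \<epsilon> \<delta>" "\<gamma> \<in> PS.A" "\<delta> \<in> PS.A"
    "fst r \<in> PS.A" "snd r \<in> PS.A" "v (snd r) = v (fst r)"
    using assms(1) by (rule arcE)
  show "edge_source (psi_edge x e y) = psi x (edge_source e) y"
    using e assms(2,3) by (cases \<epsilon>) (simp_all add: psi_append m_assoc)
  show "edge_target (psi_edge x e y) = psi x (edge_target e) y"
    using e assms(2,3) by (cases \<epsilon>) (simp_all add: psi_append m_assoc)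
qed

lemma old_rel:
  assumes "(u, w) \<in> rels P" "x \<in> carrier S" "y \<in> carrier S" "x \<otimes> v u \<otimes> y \<in> L_class"
  shows "(psi x u y, psi x w y) \<in> rels PG"
proof -
  have "(psi x u y, psi x w y) \<in> {(psi x u y, psi x w y) | x y.
      x \<in> carrier S \<and> y \<in> carrier S \<and> x \<otimes> v u \<otimes> y \<in> L_class}"
    using assms(2-4) by blast
  then have "(psi x u y, psi x w y) \<in> (\<Union>(u, w)\<in>rels P. {(psi x u y, psi x w y) | x y.
      x \<in> carrier S \<and> y \<in> carrier S \<and> x \<otimes> v u \<otimes> y \<in> L_class})"
    by (intro UN_I[OF assms(1)]) simp
  then show ?thesis
    unfolding PG_def by simp
qed

lemma psi_edge_in_arcs:
  assumes "e \<in> arcs (derivation_graph P)" "x \<in> carrier S" "y \<in> carrier S"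
    and "x \<otimes> v (edge_source e) \<otimes> y \<in> L_class"
  shows "psi_edge x e y \<in> arcs (derivation_graph PG)"
  using assms(1)
proof (cases rule: arcE)
  case (1 \<gamma> r \<epsilon> \<delta>)
  have L: "x \<otimes> (v \<gamma> \<otimes> (v (fst r) \<otimes> (v \<delta> \<otimes> y))) \<in> L_class"
    using assms 1 v_source[of \<gamma> r \<epsilon> \<delta>] by (simp add: m_assoc)
  have "psi x \<gamma> (v (fst r) \<otimes> (v \<delta> \<otimes> y)) \<in> lists B"
    using L 1 assms(2,3) by (intro psi_words) (simp_all add: m_assoc)
  moreover have "psi (x \<otimes> v \<gamma> \<otimes> v (fst r)) \<delta> y \<in> lists B"
    using L 1 assms(2,3) by (intro psi_words) (simp_all add: m_assoc)
  moreover have "(psi (x \<otimes> v \<gamma>) (fst r) (v \<delta> \<otimes> y), psi (x \<otimes> v \<gamma>) (snd r) (v \<delta> \<otimes> y)) \<in> rels PG"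
    using L 1 assms(2,3) by (intro old_rel) (simp_all add: m_assoc)
  ultimately show ?thesis
    using 1 by (simp add: derivation_graph_def)
qed

lemma psi_edge_cong:
  assumes "e \<in> arcs (derivation_graph P)" "(x, x') \<in> green_L S" "y \<in> carrier S" "y' \<in> carrier S"
    and "(x \<otimes> v (edge_source e) \<otimes> y, x \<otimes> v (edge_source e) \<otimes> y') \<in> green_H S"
  shows "psi_edge x e y = psi_edge x' e y'"
  using assms(1)
proof (cases rule: arcE)
  case (1 \<gamma> r \<epsilon> \<delta>)
  note x = green_L_carrier[OF assms(2)]
  have H: "(x \<otimes> (v \<gamma> \<otimes> (v (fst r) \<otimes> (v \<delta> \<otimes> y))), x \<otimes> (v \<gamma> \<otimes> (v (fst r) \<otimes> (v \<delta> \<otimes> y')))) \<in> green_H S"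
    using assms(1,3-5) 1 v_source[of \<gamma> r \<epsilon> \<delta>] x by (simp add: m_assoc)
  have "psi x \<gamma> (v (fst r) \<otimes> (v \<delta> \<otimes> y)) = psi x' \<gamma> (v (fst r) \<otimes> (v \<delta> \<otimes> y'))"
    using H assms(2-4) 1 x by (intro psi_cong) (simp_all add: m_assoc)
  moreover have "psi (x \<otimes> v \<gamma>) (fst r) (v \<delta> \<otimes> y) = psi (x' \<otimes> v \<gamma>) (fst r) (v \<delta> \<otimes> y')"
    using H assms(2-4) 1 x by (intro psi_cong green_L_mult) (simp_all add: m_assoc)
  moreover have "psi (x \<otimes> v \<gamma>) (snd r) (v \<delta> \<otimes> y) = psi (x' \<otimes> v \<gamma>) (snd r) (v \<delta> \<otimes> y')"
    using H assms(2-4) 1 x by (intro psi_cong green_L_mult) (simp_all add: m_assoc)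
  moreover have "psi (x \<otimes> v \<gamma> \<otimes> v (fst r)) \<delta> y = psi (x' \<otimes> v \<gamma> \<otimes> v (fst r)) \<delta> y'"
    using H assms(2-4) 1 x by (intro psi_cong green_L_mult) (simp_all add: m_assoc)
  ultimately show ?thesis
    using 1 by simp
qed

lemma psi_edge_act:
  assumes "e \<in> arcs (derivation_graph P)" "x \<in> carrier S" "y \<in> carrier S" "\<gamma> \<in> PS.A" "\<delta> \<in> PS.A"
  shows "psi_edge x (edge_act \<gamma> e \<delta>) y =
    edge_act (psi x \<gamma> (v (edge_source e) \<otimes> (v \<delta> \<otimes> y))) (psi_edge (x \<otimes> v \<gamma>) e (v \<delta> \<otimes> y))
      (psi (x \<otimes> v \<gamma> \<otimes> v (edge_source e)) \<delta> y)"
  using assms(1)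
proof (cases rule: arcE)
  case (1 \<alpha> r \<epsilon> \<beta>)
  then show ?thesis
    using assms v_source[of \<alpha> r \<epsilon> \<beta>] by (simp add: psi_append m_assoc)
qed

lemma Psi_cong:
  assumes "path_betw PS.K u p w" "(x, x') \<in> green_L S" "y \<in> carrier S" "y' \<in> carrier S"
    and "(x \<otimes> v u \<otimes> y, x \<otimes> v u \<otimes> y') \<in> green_H S"
  shows "Psi x p y = Psi x' p y'"
  using assms(1,5)
proof (induction p arbitrary: u)
  case (Cons e p)
  then have e: "e \<in> arcs (derivation_graph P)" "u = edge_source e" "path_betw PS.K (edge_target e) p w"
    by simp_all
  have "Psi x p y = Psi x' p y'"
    using Cons.IH[OF e(3)] Cons.prems(2) e v_arc by simp
  moreover have "psi_edge x e y = psi_edge x' e y'"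
    using Cons.prems(2) e assms(2-4) by (intro psi_edge_cong) simp_all
  ultimately show ?case by simp
qed simp

text \<open>The value of the vertex is constant along a path, so \<open>\<gamma>\<close> and
  \<open>\<delta>\<close> receive the same labels at every arc.\<close>

lemma Psi_act:
  assumes "path_betw PS.K u p w" "x \<in> carrier S" "y \<in> carrier S" "\<gamma> \<in> PS.A" "\<delta> \<in> PS.A"
  shows "Psi x (act \<gamma> p \<delta>) y =
    act (psi x \<gamma> (v u \<otimes> (v \<delta> \<otimes> y))) (Psi (x \<otimes> v \<gamma>) p (v \<delta> \<otimes> y)) (psi (x \<otimes> v \<gamma> \<otimes> v u) \<delta> y)"
  using assms(1)
proof (induction p arbitrary: u)
  case (Cons e p)
  then have e: "e \<in> arcs (derivation_graph P)" "u = edge_source e" "path_betw PS.K (edge_target e) p w"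
    by simp_all
  then show ?case
    using Cons.IH[OF e(3)] psi_edge_act[OF e(1) assms(2-5)] v_arc[OF e(1)] by simp
qed simp

text \<open>\<open>XG\<close> is itself built from paths over \<open>PG\<close>, so path facts are
  first needed with nothing adjoined.\<close>

sublocale G0: squier PG "{}"
  using is_presentation_PG by unfold_locales simp_all

lemma psi_path0:
  assumes "path_betw PS.K u p w" "x \<in> carrier S" "y \<in> carrier S" "x \<otimes> v u \<otimes> y \<in> L_class"
  shows "path_betw G0.K (psi x u y) (Psi x p y) (psi x w y)"
  using assms(1,4)
proof (induction p arbitrary: u)
  case Nil
  then show ?case
    using psi_words[of w x y] assms(2,3) by auto
next
  case (Cons e p)
  then have e: "e \<in> arcs (derivation_graph P)" "u = edge_source e" "path_betw PS.K (edge_target e) p w"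
    by simp_all
  then show ?case
    using Cons.IH[OF e(3)] Cons.prems(2) psi_edge_in_arcs[OF e(1) assms(2,3)]
      psi_edge_ends[OF e(1) assms(2,3)] v_arc[OF e(1)] by simp
qed

text \<open>Applies the letter relations from left to right, leading from \<open>w\<close> to
  \<open>tau w\<close>.\<close>

primrec eta :: "'c list \<Rightarrow> 'c edge list" where
  "eta [] = []"
| "eta (b # w) = Edge [] ([b], tau [b]) True w # act (tau [b]) (eta w) []"

lemma letter_rel: "b \<in> B \<Longrightarrow> ([b], tau [b]) \<in> rels PG"
  by (simp add: PG_def)

lemma eta_path0: "w \<in> lists B \<Longrightarrow> path_betw G0.K w (eta w) (tau w)"
proof (induction w)
  case (Cons b w)
  have "path_betw G0.K (tau [b] @ w) (act (tau [b]) (eta w) []) (tau [b] @ tau w)"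
    using Cons tau_words[of "[b]"] by (intro G0.path_lact) simp_all
  then show ?case
    using Cons.prems tau_append[of "[b]" w] letter_rel by simp
qed simp

lemma eta_append:
  assumes "u \<in> lists B" "w \<in> lists B"
  shows "eta (u @ w) = act [] (eta u) w @ act (tau u) (eta w) []"
  using assms(1)
proof (induction u)
  case (Cons b u)
  then show ?case
    using tau_append[of "[b]" u] by simp
qed simp

text \<open>For a relation of \<open>PG\<close> such a derivation exists because both words act
  equally on \<open>h\<close>.\<close>

definition old_path where
  "old_path u w = (SOME p. path_betw PS.K (uh @ phi u) p (uh @ phi w))"

lemma val_eq_imp_path:
  assumes "u \<in> lists B" "w \<in> lists B" "(val u, val w) \<in> \<sigma>"
  shows "\<exists>p. path_betw PS.K (uh @ phi u) p (uh @ phi w)"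
  using assms schutz_cong_iff[OF h_L_class val_Stab val_Stab, of u w]
  by (subst v_eq_iff_path[symmetric]) simp_all

lemma rels_PG_words: "(u, w) \<in> rels PG \<Longrightarrow> u \<in> lists B \<and> w \<in> lists B"
  using G0.rels_in_words by simp

lemma old_path:
  assumes "(u, w) \<in> rels PG"
  shows "path_betw PS.K (uh @ phi u) (old_path u w) (uh @ phi w)"
proof -
  have "\<exists>p. path_betw PS.K (uh @ phi u) p (uh @ phi w)"
    using rels_PG_words[OF assms] rels_PG_val[OF assms] by (intro val_eq_imp_path) simp_all
  then show ?thesis
    unfolding old_path_def by (rule someI_ex)
qed

text \<open>The relation conjugated by \<open>eta\<close>: a path from \<open>tau u\<close> to
  \<open>tau w\<close>, to be compared with the image of \<open>old_path u w\<close>.\<close>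

definition new_path where
  "new_path u w = inv_arcs G0.K (eta u) @ [Edge [] (u, w) True []] @ eta w"

lemma rel_edge_path0: "(u, w) \<in> rels PG \<Longrightarrow> path_betw G0.K u [Edge [] (u, w) True []] w"
  using rels_PG_words by simp

lemma new_path0:
  assumes "(u, w) \<in> rels PG"
  shows "path_betw G0.K (tau u) (new_path u w) (tau w)"
  unfolding new_path_def
  using G0.path_append[OF G0.path_inv[OF eta_path0] G0.path_append[OF rel_edge_path0[OF assms] eta_path0]]
    rels_PG_words[OF assms] by blast

text \<open>The second family forces the two natural ways of lifting a relation of the group, through
  the old presentation with any left context and directly, to agree.\<close>

definition XG :: "('c list, 'c edge) path set" where
  "XG = (\<Union>(c, p)\<in>X. {(psi x c y, Psi x p y) | x y.
      x \<in> carrier S \<and> y \<in> carrier S \<and> x \<otimes> v c \<otimes> y \<in> L_class}) \<union>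
    (\<Union>(u, w)\<in>rels PG. {(zeta x @ tau u,
        Psi x (old_path u w) \<one> @ inv_arcs G0.K (act (zeta x) (new_path u w) [])) | x.
      x \<in> carrier S \<and> x \<otimes> h \<in> L_class})"

lemma X_path: "(c, p) \<in> X \<Longrightarrow> path_betw PS.K c p c"
  using PS.closed by (auto simp: closed_paths_def PS.path_squier_iff)

lemma finite_XG: "finite XG"
proof -
  have "finite {(psi x c y, Psi x p y) | x y.
      x \<in> carrier S \<and> y \<in> carrier S \<and> x \<otimes> v c \<otimes> y \<in> L_class}" if cp: "(c, p) \<in> X" for c p
  proof (rule finite_contexts[OF finite_left finite_right])
    show "v c \<in> carrier S"
      using PS.path_words[OF X_path[OF cp]] by simp
    fix x x' y y' assume *: "(x, x') \<in> green_L S" "y \<in> carrier S" "y' \<in> carrier S"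
      "(x \<otimes> v c \<otimes> y, x \<otimes> v c \<otimes> y') \<in> green_H S"
    then show "(psi x c y, Psi x p y) = (psi x' c y', Psi x' p y')"
      using psi_cong[OF _ *] Psi_cong[OF X_path[OF cp] *] PS.path_words[OF X_path[OF cp]] by simp
  qed
  then have "finite (\<Union>(c, p)\<in>X. {(psi x c y, Psi x p y) | x y.
      x \<in> carrier S \<and> y \<in> carrier S \<and> x \<otimes> v c \<otimes> y \<in> L_class})"
    using finite_X by (intro finite_UN_I) auto
  moreover have "finite {(zeta x @ tau u,
        Psi x (old_path u w) \<one> @ inv_arcs G0.K (act (zeta x) (new_path u w) [])) | x.
      x \<in> carrier S \<and> x \<otimes> h \<in> L_class}" (is "finite {?f x | x. ?C x}") if uw: "(u, w) \<in> rels PG" for u w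
  proof (rule finite_subset)
    \<comment> \<open>A right context on which \<open>?f\<close> does not depend is added to match
      \<open>finite_contexts\<close>; the value \<open>\<one>\<close> gives the inclusion.\<close>
    show "{?f x | x. ?C x} \<subseteq> {?f x | x y. x \<in> carrier S \<and> y \<in> carrier S \<and> x \<otimes> h \<otimes> y \<in> L_class}"
    proof (rule subsetI)
      fix z assume "z \<in> {?f x | x. ?C x}"
      then obtain x where "z = ?f x" "x \<in> carrier S" "x \<otimes> h \<otimes> \<one> \<in> L_class"
        by auto
      then show "z \<in> {?f x | x y. x \<in> carrier S \<and> y \<in> carrier S \<and> x \<otimes> h \<otimes> y \<in> L_class}"
        using one_closed by blast
    qed
    show "finite {?f x | x y. x \<in> carrier S \<and> y \<in> carrier S \<and> x \<otimes> h \<otimes> y \<in> L_class}"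
    proof (rule finite_contexts[OF finite_left finite_right h_carrier])
      fix x x' y y' assume *: "(x, x') \<in> green_L S"
      note x = green_L_carrier[OF *]
      have "zeta x = zeta x'"
        unfolding zeta_def using * x by (intro psi_cong) (auto intro: green_H_refl)
      moreover have "Psi x (old_path u w) \<one> = Psi x' (old_path u w) \<one>"
        using Psi_cong[OF old_path[OF uw] *, of \<one> \<one>] x rels_PG_words[OF uw] green_H_refl by simp
      ultimately show "?f x = ?f x'" by simp
    qed
  qed
  then have "finite (\<Union>(u, w)\<in>rels PG. {(zeta x @ tau u,
        Psi x (old_path u w) \<one> @ inv_arcs G0.K (act (zeta x) (new_path u w) [])) | x.
      x \<in> carrier S \<and> x \<otimes> h \<in> L_class})"
    using finite_rels_PG by (intro finite_UN_I) auto
  ultimately show ?thesis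
    by (simp add: XG_def)
qed

lemma Psi_old_path0:
  assumes "(u, w) \<in> rels PG" "x \<in> carrier S" "x \<otimes> h \<in> L_class"
  shows "path_betw G0.K (zeta x @ tau u) (Psi x (old_path u w) \<one>) (zeta x @ tau w)"
proof -
  note uw = rels_PG_words[OF assms(1)]
  have "x \<otimes> h \<otimes> val u \<in> L_class"
    using L_class_Stab(2)[OF assms(3) val_Stab] uw by simp
  then have "path_betw G0.K (psi x (uh @ phi u) \<one>) (Psi x (old_path u w) \<one>) (psi x (uh @ phi w) \<one>)"
    using assms uw by (intro psi_path0 old_path) (simp_all add: m_assoc)
  then show ?thesis
    using psi_uh_phi assms uw by simp
qed

lemma XG_closed: "XG \<subseteq> closed_paths (squier_complex PG)"
proof -
  have "path_betw G0.K (psi x c y) (Psi x p y) (psi x c y)"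
    if "(c, p) \<in> X" "x \<in> carrier S" "y \<in> carrier S" "x \<otimes> v c \<otimes> y \<in> L_class" for c p x y
    using psi_path0[OF X_path] that by blast
  moreover have "path_betw G0.K (zeta x @ tau u)
      (Psi x (old_path u w) \<one> @ inv_arcs G0.K (act (zeta x) (new_path u w) [])) (zeta x @ tau u)"
    if "(u, w) \<in> rels PG" "x \<in> carrier S" "x \<otimes> h \<in> L_class" for u w x
    using Psi_old_path0[OF that] G0.path_inv[OF G0.path_lact[OF _ new_path0[OF that(1)]]]
      zeta_words[OF that(2,3)] by (intro G0.path_append) simp_all
  ultimately show ?thesis
    by (auto simp: XG_def closed_paths_def G0.path_squier_iff)
qed

sublocale G: squier PG XG
  using is_presentation_PG XG_closed by unfold_locales

lemma path_G0_iff [simp]: "path_betw G0.K u p w \<longleftrightarrow> path_betw G.K u p w"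
  using G0.path_squier_iff G.path_squier_iff by blast

lemma inv_arcs_G0 [simp]: "inv_arcs G0.K = inv_arcs G.K"
  by (simp add: fun_eq_iff inv_arcs_def)

lemmas psi_path = psi_path0[unfolded path_G0_iff]
lemmas eta_path = eta_path0[unfolded path_G0_iff]
lemmas new_path = new_path0[unfolded path_G0_iff]
lemmas rel_edge_path = rel_edge_path0[unfolded path_G0_iff]
lemmas Psi_old_path = Psi_old_path0[unfolded path_G0_iff]

lemma Psi_inv: "Psi x (inv_arcs PS.K p) y = inv_arcs G.K (Psi x p y)"
  by (induction p) simp_all

text \<open>Source and target of an edge have the same value. Hence the two occurrences of each edge
  in the square see the same outer factors, and the square maps to a square.\<close>

lemma psi_interchange_path:
  assumes "e \<in> arcs (derivation_graph P)" "f \<in> arcs (derivation_graph P)"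
    and "x \<in> carrier S" "y \<in> carrier S"
    and "interchange_path e f = (c, p)"
  shows "(psi x c y, Psi x p y) =
    interchange_path (psi_edge x e (v (edge_source f) \<otimes> y)) (psi_edge (x \<otimes> v (edge_source e)) f y)"
proof -
  note ends = PS.arc_ends_in_words[OF assms(1)] PS.arc_ends_in_words[OF assms(2)]
  have c: "c = edge_source e @ edge_source f"
    and p: "p = [edge_act [] e (edge_source f), edge_act (edge_target e) f [],
      edge_act [] (edge_inv e) (edge_target f), edge_act (edge_source e) (edge_inv f) []]"
    using assms(5) by (simp_all add: interchange_path_def)
  show ?thesis
    unfolding c p interchange_path_def
    using assms(1-4) ends v_arc[OF assms(1)] v_arc[OF assms(2)]
    by (simp add: psi_append psi_edge_act psi_edge_ends)
qed

text \<open>Words whose product with \<open>x\<close> and \<open>y\<close> lies in the L-class form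
  a union of components, as values are constant along arcs. There interchange paths go to
  interchange paths, and translates of \<open>X\<close> to translates of the first family of
  \<open>XG\<close>.\<close>

lemma psi_htpy:
  assumes xy: "x \<in> carrier S" "y \<in> carrier S"
    and "PS.htpy u p q w" "x \<otimes> v u \<otimes> y \<in> L_class"
  shows "G.htpy (psi x u y) (Psi x p y) (Psi x q y) (psi x w y)"
  unfolding Psi_def
proof (rule homotopic_map[where K = PS.K and K' = G.K and F = "\<lambda>w. psi x w y" and
      V = "{w \<in> PS.A. x \<otimes> v w \<otimes> y \<in> L_class}"])
  fix c r assume cr: "(c, r) \<in> defining PS.K" "path_betw PS.K c r c"
    "c \<in> {w \<in> PS.A. x \<otimes> v w \<otimes> y \<in> L_class}"
  then have c: "c \<in> PS.A" "x \<otimes> v c \<otimes> y \<in> L_class" by simp_all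
  have "G.htpy (psi x c y) (Psi x r y) [] (psi x c y)"
    using cr(1)
  proof (cases rule: PS.defining_cases)
    case (interchange e f)
    have "c = edge_source e @ edge_source f"
      using interchange by (simp add: interchange_path_def)
    then have L: "x \<otimes> v (edge_source e) \<otimes> v (edge_source f) \<otimes> y \<in> L_class"
      using c xy PS.arc_ends_in_words interchange by (simp add: m_assoc)
    have "psi_edge x e (v (edge_source f) \<otimes> y) \<in> arcs (derivation_graph PG)"
      "psi_edge (x \<otimes> v (edge_source e)) f y \<in> arcs (derivation_graph PG)"
      using L xy interchange PS.arc_ends_in_words by (auto intro!: psi_edge_in_arcs simp: m_assoc)
    then have "(psi x c y, Psi x r y) \<in> defining G.K"
      using psi_interchange_path[OF interchange(1,2) xy interchange(3)[symmetric]]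
        G.defining_interchange by simp
    then show ?thesis
      using psi_path[OF cr(2) xy c(2)] by (intro G.htpy_defining)
  next
    case (translate \<alpha> u q \<beta>)
    have q: "path_betw PS.K u q u"
      using translate(3) by (rule X_path)
    have u: "u \<in> PS.A"
      using PS.path_words[OF q] by simp
    have L: "x \<otimes> v \<alpha> \<otimes> v u \<otimes> (v \<beta> \<otimes> y) \<in> L_class"
      using c xy u translate by (simp add: m_assoc)
    \<comment> \<open>The contexts absorb \<open>\<alpha>\<close> and \<open>\<beta>\<close>: the
      image is a translate of the member of \<open>XG\<close> for
      \<open>x \<otimes> v \<alpha>\<close> and \<open>v \<beta> \<otimes> y\<close>.\<close>
    then have "(psi (x \<otimes> v \<alpha>) u (v \<beta> \<otimes> y), Psi (x \<otimes> v \<alpha>) q (v \<beta> \<otimes> y)) \<in> XG"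
      unfolding XG_def using translate xy by fastforce
    then have "G.htpy (psi x \<alpha> (v u \<otimes> (v \<beta> \<otimes> y)) @ psi (x \<otimes> v \<alpha>) u (v \<beta> \<otimes> y) @ psi (x \<otimes> v \<alpha> \<otimes> v u) \<beta> y)
        (act (psi x \<alpha> (v u \<otimes> (v \<beta> \<otimes> y))) (Psi (x \<otimes> v \<alpha>) q (v \<beta> \<otimes> y)) (psi (x \<otimes> v \<alpha> \<otimes> v u) \<beta> y))
        (act (psi x \<alpha> (v u \<otimes> (v \<beta> \<otimes> y))) [] (psi (x \<otimes> v \<alpha> \<otimes> v u) \<beta> y))
        (psi x \<alpha> (v u \<otimes> (v \<beta> \<otimes> y)) @ psi (x \<otimes> v \<alpha>) u (v \<beta> \<otimes> y) @ psi (x \<otimes> v \<alpha> \<otimes> v u) \<beta> y)"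
      using L xy u translate by (intro G.htpy_act G.htpy_base) (auto intro!: psi_words simp: m_assoc)
    then show ?thesis
      using translate xy u Psi_act[OF q xy translate(1,2)] by (simp add: psi_append m_assoc)
  qed
  then show "G.htpy (psi x c y) (map (\<lambda>e. psi_edge x e y) r) [] (psi x c y)"
    by (simp add: Psi_def)
qed (use assms psi_words psi_edge_in_arcs psi_edge_ends v_arc PS.arc_ends_in_words
      PS.path_words[OF conjunct1[OF PS.htpy_path[OF assms(3)]]] PS.involutive_complex_axioms G.involutive_complex_axioms in auto)

section \<open>Lifting paths from the group to the monoid\<close>

abbreviation z where "z \<equiv> zeta \<one>"

declare tau_words [simp]

lemma z_words [simp]: "z \<in> lists B"
  using zeta_words[of \<one>] h_L_class by simp

definition unit_edge where "unit_edge = Edge [] ([], z) True []"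

lemma unit_rel: "([], z) \<in> rels PG"
  by (simp add: PG_def)

lemma unit_edge_path: "path_betw G.K [] [unit_edge] z"
  by (simp add: unit_edge_def unit_rel)

lemma unit_path: "w \<in> lists B \<Longrightarrow> path_betw G.K w (act [] [unit_edge] w) (z @ w)"
  using G.path_ract[OF _ unit_edge_path, of w] by simp

text \<open>For words over \<open>B\<close> it ends, by \<open>psi_uh_phi\<close>, at
  \<open>psi \<one> (uh @ phi w) \<one>\<close>; so it compares \<open>w\<close> with the image of
  its lift.\<close>

definition full where "full w = eta w @ act [] [unit_edge] (tau w)"

lemma full_path: "w \<in> lists B \<Longrightarrow> path_betw G.K w (full w) (z @ tau w)"
  unfolding full_def
  using G.path_append[OF eta_path unit_path] by simp

lemma base_square:
  assumes uw: "(u, w) \<in> rels PG" and x: "x \<in> carrier S" "x \<otimes> h \<in> L_class"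
  shows "G.htpy (zeta x @ tau u) (Psi x (old_path u w) \<one>) (act (zeta x) (new_path u w) []) (zeta x @ tau w)"
proof (rule G.htpy_of_closed)
  have "(zeta x @ tau u, Psi x (old_path u w) \<one> @ inv_arcs G0.K (act (zeta x) (new_path u w) [])) \<in> XG"
    unfolding XG_def using x by (intro UnI2 UN_I[OF uw]) auto
  then show "G.htpy (zeta x @ tau u) (Psi x (old_path u w) \<one> @ inv_arcs G.K (act (zeta x) (new_path u w) [])) []
      (zeta x @ tau u)"
    by (intro G.htpy_base) simp
  show "path_betw G.K (zeta x @ tau u) (act (zeta x) (new_path u w) []) (zeta x @ tau w)"
    using zeta_words[OF x] by (intro G.path_lact new_path[OF uw]) simp
qed (rule Psi_old_path[OF uw x])

text \<open>\<open>eta\<close> splits over \<open>\<alpha>\<close>, the rewritten factor and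
  \<open>\<beta>\<close>. The outer pieces pass the rewriting by interchange, and the middle piece
  is the definition of \<open>new_path\<close>.\<close>

lemma eta_natural:
  assumes words: "\<alpha> \<in> lists B" "\<beta> \<in> lists B" and uw: "(u, w) \<in> rels PG"
  shows "G.htpy (\<alpha> @ u @ \<beta>) (Edge \<alpha> (u, w) True \<beta> # eta (\<alpha> @ w @ \<beta>))
    (eta (\<alpha> @ u @ \<beta>) @ act (tau \<alpha>) (new_path u w) (tau \<beta>)) (tau (\<alpha> @ w @ \<beta>))"
proof -
  note uw' = rels_PG_words[OF uw]
  let ?s = "[Edge [] (u, w) True []]" and ?r = "new_path u w"
  have s: "path_betw G.K u ?s w"
    by (rule rel_edge_path[OF uw])
  have eta_split: "eta (\<alpha> @ y @ \<beta>) = act [] (eta \<alpha>) (y @ \<beta>) @ act (tau \<alpha>) (eta y) \<beta> @ act (tau \<alpha> @ tau y) (eta \<beta>) []"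
    if "y \<in> lists B" for y
    using that words by (simp add: eta_append)
  have tau_split: "tau (\<alpha> @ y @ \<beta>) = tau \<alpha> @ tau y @ tau \<beta>" if "y \<in> lists B" for y
    using that words by (simp add: tau_append)
  have p1: "path_betw G.K (\<alpha> @ u @ \<beta>) (act [] (eta \<alpha>) (u @ \<beta>)) (tau \<alpha> @ u @ \<beta>)"
    using G.path_ract[OF _ eta_path[OF words(1)], of "u @ \<beta>"] words uw' by simp
  have p2: "path_betw G.K (tau \<alpha> @ w @ \<beta>) (act (tau \<alpha>) (eta w) \<beta>) (tau \<alpha> @ tau w @ \<beta>)"
    using words uw' by (intro G.path_act eta_path) simp_all
  have p3: "path_betw G.K (tau \<alpha> @ tau w @ \<beta>) (act (tau \<alpha> @ tau w) (eta \<beta>) []) (tau \<alpha> @ tau w @ tau \<beta>)"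
    using G.path_lact[OF _ eta_path[OF words(2)], of "tau \<alpha> @ tau w"] words uw' by simp
  have p4: "path_betw G.K (tau \<alpha> @ u @ \<beta>) (act (tau \<alpha>) (eta u) \<beta>) (tau \<alpha> @ tau u @ \<beta>)"
    using words uw' by (intro G.path_act eta_path) simp_all
  have "G.htpy (\<alpha> @ u @ \<beta>) (act [] (eta \<alpha>) (u @ \<beta>) @ act (tau \<alpha>) ?s \<beta>)
      (act \<alpha> ?s \<beta> @ act [] (eta \<alpha>) (w @ \<beta>)) (tau \<alpha> @ w @ \<beta>)"
    using G.interchange[OF eta_path[OF words(1)] G.path_ract[OF _ s], of \<beta>] words by simp
  from G.htpy_append_right[OF G.htpy_sym[OF this] G.path_append[OF p2 p3]]
  have "G.htpy (\<alpha> @ u @ \<beta>) (Edge \<alpha> (u, w) True \<beta> # eta (\<alpha> @ w @ \<beta>))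
      (act [] (eta \<alpha>) (u @ \<beta>) @ act (tau \<alpha>) (?s @ eta w) \<beta> @ act (tau \<alpha> @ tau w) (eta \<beta>) [])
      (tau \<alpha> @ tau w @ tau \<beta>)"
    using uw' by (simp add: eta_split)
  also have "G.htpy (\<alpha> @ u @ \<beta>)
      (act [] (eta \<alpha>) (u @ \<beta>) @ act (tau \<alpha>) (?s @ eta w) \<beta> @ act (tau \<alpha> @ tau w) (eta \<beta>) [])
      (act [] (eta \<alpha>) (u @ \<beta>) @ act (tau \<alpha>) (eta u @ ?r) \<beta> @ act (tau \<alpha> @ tau w) (eta \<beta>) [])
      (tau \<alpha> @ tau w @ tau \<beta>)"
  proof (rule G.htpy_context[OF G.htpy_act p1 p3])
    \<comment> \<open>\<open>?r\<close> begins with the inverse of \<open>eta u\<close>, so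
      \<open>eta u @ ?r\<close> contracts to the relation followed by \<open>eta w\<close>.\<close>
    have "path_betw G.K u (?s @ eta w) (tau w)"
      using s eta_path uw' by (blast intro: G.path_append)
    from G.htpy_append_right[OF G.htpy_inv_right[OF eta_path] this]
    have "G.htpy u (eta u @ ?r) (?s @ eta w) (tau w)"
      using uw' by (simp add: new_path_def)
    then show "G.htpy u (?s @ eta w) (eta u @ ?r) (tau w)"
      by (rule G.htpy_sym)
  qed (use words in simp_all)
  also have "G.htpy (\<alpha> @ u @ \<beta>)
      (act [] (eta \<alpha>) (u @ \<beta>) @ act (tau \<alpha>) (eta u @ ?r) \<beta> @ act (tau \<alpha> @ tau w) (eta \<beta>) [])
      (eta (\<alpha> @ u @ \<beta>) @ act (tau \<alpha>) ?r (tau \<beta>)) (tau \<alpha> @ tau w @ tau \<beta>)"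
  proof -
    have "G.htpy (tau \<alpha> @ tau u @ \<beta>)
        (act (tau \<alpha>) ?r \<beta> @ act (tau \<alpha> @ tau w) (eta \<beta>) [])
        (act (tau \<alpha> @ tau u) (eta \<beta>) [] @ act (tau \<alpha>) ?r (tau \<beta>)) (tau \<alpha> @ tau w @ tau \<beta>)"
      using G.interchange[OF G.path_lact[OF _ new_path[OF uw], of "tau \<alpha>"] eta_path[OF words(2)]] words
      by simp
    from G.htpy_append_left[OF G.path_append[OF p1 p4] this]
    show ?thesis
      using uw' by (simp add: eta_split)
  qed
  finally show ?thesis
    using uw' by (simp add: tau_split)
qed

text \<open>The unit edge inserts \<open>z\<close> at the far left, so it interchanges with the
  rewriting inside \<open>tau (\<alpha> @ u @ \<beta>)\<close>.\<close>

lemma full_natural: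
  assumes words: "\<alpha> \<in> lists B" "\<beta> \<in> lists B" and uw: "(u, w) \<in> rels PG"
  shows "G.htpy (\<alpha> @ u @ \<beta>) (Edge \<alpha> (u, w) True \<beta> # full (\<alpha> @ w @ \<beta>))
    (full (\<alpha> @ u @ \<beta>) @ act (z @ tau \<alpha>) (new_path u w) (tau \<beta>)) (z @ tau (\<alpha> @ w @ \<beta>))"
proof -
  note uw' = rels_PG_words[OF uw]
  let ?r = "act (tau \<alpha>) (new_path u w) (tau \<beta>)" and ?u = "\<alpha> @ u @ \<beta>" and ?w = "\<alpha> @ w @ \<beta>"
  have uw_words: "?u \<in> lists B" "?w \<in> lists B"
    using words uw' by simp_all
  have r: "path_betw G.K (tau ?u) ?r (tau ?w)"
    using G.path_act[OF _ _ new_path[OF uw], of "tau \<alpha>" "tau \<beta>"] words uw' by (simp add: tau_append)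
  have "G.htpy ?u (Edge \<alpha> (u, w) True \<beta> # full ?w) (eta ?u @ ?r @ act [] [unit_edge] (tau ?w)) (z @ tau ?w)"
    using G.htpy_append_right[OF eta_natural[OF assms] unit_path] uw_words
    by (simp add: full_def)
  also have "G.htpy ?u (eta ?u @ ?r @ act [] [unit_edge] (tau ?w))
      (eta ?u @ act [] [unit_edge] (tau ?u) @ act z ?r []) (z @ tau ?w)"
    using G.htpy_append_left[OF eta_path[OF uw_words(1)] G.htpy_sym]
      G.interchange[OF unit_edge_path r] by simp
  finally show ?thesis
    by (simp add: full_def)
qed

lemma val_L_class: "u \<in> lists B \<Longrightarrow> x \<in> L_class \<Longrightarrow> x \<otimes> val u \<in> L_class"
  using L_class_Stab(2) val_Stab by blast

text \<open>\<open>phi y\<close> has its value in the stabiliser and so leaves the labels along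
  \<open>p\<close> unchanged. Its own labels are those read off behind \<open>h\<close>, because
  \<open>x \<otimes> v u\<close> lies in the L-class of \<open>h\<close>.\<close>

lemma Psi_ract_phi:
  assumes p: "path_betw PS.K u p w" and x: "x \<in> carrier S" "x \<otimes> v u \<in> L_class" and y: "y \<in> lists B"
  shows "Psi x (act [] p (phi y)) \<one> = act [] (Psi x p \<one>) (tau y)"
proof -
  have u: "u \<in> PS.A"
    using PS.path_words[OF p] by simp
  have "Psi x p (val y) = Psi x p \<one>"
    using Psi_cong[OF p green_L_refl[OF x(1)], of "val y" \<one>] y x u
      green_H_sym[OF L_class_Stab(1)[OF x(2) val_Stab[OF y]]] by simp
  moreover have "psi (x \<otimes> v u) (phi y) \<one> = tau y"
    unfolding tau_def
    using L_class_iff[OF x(2)] h_L_class x u y by (intro psi_cong) (auto intro: green_H_refl)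
  ultimately show ?thesis
    using Psi_act[OF p x(1) one_closed, of "[]" "phi y"] x y u by simp
qed

text \<open>Pushing \<open>\<alpha>\<close> through \<open>h\<close> to a left factor \<open>c\<close> with \<open>h\<alpha> = ch\<close> reduces a relation in any
  context to one of the finitely many adjoined closed paths.\<close>

lemma old_path_in_context:
  assumes words: "\<alpha> \<in> lists B" "\<beta> \<in> lists B" and uw: "(u, w) \<in> rels PG"
  shows "\<exists>q. path_betw PS.K (uh @ phi (\<alpha> @ u @ \<beta>)) q (uh @ phi (\<alpha> @ w @ \<beta>)) \<and>
    G.htpy (z @ tau (\<alpha> @ u @ \<beta>)) (act (z @ tau \<alpha>) (new_path u w) (tau \<beta>)) (Psi \<one> q \<one>)
      (z @ tau (\<alpha> @ w @ \<beta>))"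
proof -
  note uw' = rels_PG_words[OF uw]
  have h\<alpha>: "h \<otimes> val \<alpha> \<in> L_class"
    using words h_L_class by (intro val_L_class)
  obtain c where c: "c \<in> carrier S" "h \<otimes> val \<alpha> = c \<otimes> h"
    using L_class_iff[OF h_L_class] h\<alpha> green_L_factor by blast
  have ch: "c \<otimes> h \<in> L_class"
    using h\<alpha> c by simp
  define \<alpha>' where "\<alpha>' = word c"
  have \<alpha>': "\<alpha>' \<in> PS.A" "v \<alpha>' = c"
    using word[OF c(1)] by (simp_all add: \<alpha>'_def)
  have "v (uh @ phi \<alpha>) = v (\<alpha>' @ uh)"
    using \<alpha>' words c by simp
  then obtain \<theta> where \<theta>: "path_betw PS.K (uh @ phi \<alpha>) \<theta> (\<alpha>' @ uh)"
    using v_eq_iff_path[of "uh @ phi \<alpha>" "\<alpha>' @ uh"] \<alpha>' words by auto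
  let ?q0 = "old_path u w"
  \<comment> \<open>\<open>old_path\<close> conjugated by \<open>\<theta>\<close>: pass to
    \<open>\<alpha>'\<close> as left context, rewrite there, and pass back.\<close>
  define q where "q = act [] \<theta> (phi (u @ \<beta>)) @ act \<alpha>' ?q0 (phi \<beta>) @ act [] (inv_arcs PS.K \<theta>) (phi (w @ \<beta>))"
  have q1: "path_betw PS.K (uh @ phi (\<alpha> @ u @ \<beta>)) (act [] \<theta> (phi (u @ \<beta>))) (\<alpha>' @ uh @ phi u @ phi \<beta>)"
    using PS.path_ract[OF _ \<theta>, of "phi (u @ \<beta>)"] words uw' by (simp add: phi_append)
  have q2: "path_betw PS.K (\<alpha>' @ uh @ phi u @ phi \<beta>) (act \<alpha>' ?q0 (phi \<beta>)) (\<alpha>' @ uh @ phi w @ phi \<beta>)"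
    using PS.path_act[OF \<alpha>'(1) _ old_path[OF uw], of "phi \<beta>"] words by simp
  have q3: "path_betw PS.K (\<alpha>' @ uh @ phi w @ phi \<beta>) (act [] (inv_arcs PS.K \<theta>) (phi (w @ \<beta>)))
      (uh @ phi (\<alpha> @ w @ \<beta>))"
    using PS.path_ract[OF _ PS.path_inv[OF \<theta>], of "phi (w @ \<beta>)"] words uw' by (simp add: phi_append)
  have q: "path_betw PS.K (uh @ phi (\<alpha> @ u @ \<beta>)) q (uh @ phi (\<alpha> @ w @ \<beta>))"
    unfolding q_def by (rule PS.path_append[OF q1 PS.path_append[OF q2 q3]])
  let ?\<Theta> = "Psi \<one> \<theta> \<one>" and ?r = "new_path u w"
  \<comment> \<open>The image of \<open>\<alpha>' @ uh\<close>; its final part \<open>zeta c\<close>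
    is what \<open>base_square\<close> expects.\<close>
  define m where "m = psi \<one> \<alpha>' h @ zeta c"
  have m: "psi \<one> (\<alpha>' @ uh) \<one> = m"
    using \<alpha>' c by (simp add: psi_append m_def zeta_def)
  have m_words: "m \<in> lists B"
    unfolding m[symmetric] using \<alpha>' c ch by (intro psi_words) simp_all
  have \<Theta>: "path_betw G.K (z @ tau \<alpha>) ?\<Theta> m"
    using psi_path[OF \<theta> one_closed one_closed] psi_uh_phi[of \<one> \<alpha>] words h\<alpha> h_L_class
    by (simp add: m)
  have Psi1: "Psi \<one> (act [] \<theta> (phi (u @ \<beta>))) \<one> = act [] ?\<Theta> (tau u @ tau \<beta>)"
    using Psi_ract_phi[OF \<theta> one_closed, of "u @ \<beta>"] words uw' h\<alpha> by (simp add: tau_append)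
  have Psi3: "Psi \<one> (act [] (inv_arcs PS.K \<theta>) (phi (w @ \<beta>))) \<one> =
      act [] (inv_arcs G.K ?\<Theta>) (tau w @ tau \<beta>)"
    using Psi_ract_phi[OF PS.path_inv[OF \<theta>] one_closed, of "w @ \<beta>"] words uw' \<alpha>' c ch
    by (simp add: tau_append Psi_inv)
  have chu: "c \<otimes> h \<otimes> val u \<in> L_class"
    using ch uw' by (intro val_L_class) simp_all
  have Psi2: "Psi \<one> (act \<alpha>' ?q0 (phi \<beta>)) \<one> = act (psi \<one> \<alpha>' h) (Psi c ?q0 \<one>) (tau \<beta>)"
  proof -
    have "psi \<one> \<alpha>' (h \<otimes> val u \<otimes> val \<beta>) = psi \<one> \<alpha>' h"
    proof (rule psi_cong[OF \<alpha>'(1) green_L_refl[OF one_closed]])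
      have "(c \<otimes> h, c \<otimes> h \<otimes> (val u \<otimes> val \<beta>)) \<in> green_H S"
        using L_class_Stab(1)[OF ch val_Stab[of "u @ \<beta>"]] words uw' by (simp add: val_append)
      then show "(\<one> \<otimes> v \<alpha>' \<otimes> (h \<otimes> val u \<otimes> val \<beta>), \<one> \<otimes> v \<alpha>' \<otimes> h) \<in> green_H S"
        using green_H_sym \<alpha>' c words uw' by (simp add: m_assoc)
    qed (use words uw' in simp_all)
    moreover have "Psi c ?q0 (val \<beta>) = Psi c ?q0 \<one>"
      using Psi_cong[OF old_path[OF uw] green_L_refl[OF c(1)], of "val \<beta>" \<one>] words uw' c
        green_H_sym[OF L_class_Stab(1)[OF chu val_Stab[OF words(2)]]] by (simp add: m_assoc)
    moreover have "psi (c \<otimes> (h \<otimes> val u)) (phi \<beta>) \<one> = tau \<beta>"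
      unfolding tau_def using L_class_iff[OF chu] h_L_class words uw' c
      by (intro psi_cong) (auto intro: green_H_refl simp: m_assoc)
    ultimately show ?thesis
      using Psi_act[OF old_path[OF uw] one_closed one_closed \<alpha>'(1), of "phi \<beta>"] \<alpha>' words uw' c
      by simp
  qed
  have \<Theta>u: "path_betw G.K (z @ tau \<alpha> @ tau u @ tau \<beta>) (act [] ?\<Theta> (tau u @ tau \<beta>)) (m @ tau u @ tau \<beta>)"
    using G.path_ract[OF _ \<Theta>, of "tau u @ tau \<beta>"] words uw' by simp
  have \<Theta>w: "path_betw G.K (z @ tau \<alpha> @ tau w @ tau \<beta>) (act [] ?\<Theta> (tau w @ tau \<beta>)) (m @ tau w @ tau \<beta>)"
    using G.path_ract[OF _ \<Theta>, of "tau w @ tau \<beta>"] words uw' by simp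
  let ?\<Theta>u = "act [] ?\<Theta> (tau u @ tau \<beta>)" and ?\<Theta>w = "act [] ?\<Theta> (tau w @ tau \<beta>)"
  have r: "path_betw G.K (tau u @ tau \<beta>) (act [] ?r (tau \<beta>)) (tau w @ tau \<beta>)"
    using words by (intro G.path_ract new_path uw) simp
  have zr: "path_betw G.K (z @ tau \<alpha> @ tau u @ tau \<beta>) (act (z @ tau \<alpha>) ?r (tau \<beta>)) (z @ tau \<alpha> @ tau w @ tau \<beta>)"
    using G.path_lact[OF _ r, of "z @ tau \<alpha>"] words by simp
  \<comment> \<open>\<open>base_square\<close> at \<open>c\<close>, translated by the labels of
    \<open>\<alpha>'\<close> on the left and by \<open>tau \<beta>\<close> on the right.\<close>
  have square: "G.htpy (m @ tau u @ tau \<beta>) (act (psi \<one> \<alpha>' h) (Psi c ?q0 \<one>) (tau \<beta>)) (act m ?r (tau \<beta>))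
      (m @ tau w @ tau \<beta>)"
    using G.htpy_act[OF _ _ base_square[OF uw c(1) ch], of "psi \<one> \<alpha>' h" "tau \<beta>"] words m_words
    by (simp add: m_def)
  have "G.htpy (z @ tau \<alpha> @ tau u @ tau \<beta>) (Psi \<one> q \<one>)
      (?\<Theta>u @ act m ?r (tau \<beta>) @ inv_arcs G.K ?\<Theta>w) (z @ tau \<alpha> @ tau w @ tau \<beta>)"
    using G.htpy_context[OF square \<Theta>u G.path_inv[OF \<Theta>w]]
    by (simp add: q_def Psi1 Psi2 Psi3 G.inv_arcs_act)
  \<comment> \<open>\<open>?\<Theta>\<close> works strictly to the left of the rewriting, so it
    interchanges with \<open>?r\<close> and then cancels.\<close>
  also have "G.htpy (z @ tau \<alpha> @ tau u @ tau \<beta>) (?\<Theta>u @ act m ?r (tau \<beta>) @ inv_arcs G.K ?\<Theta>w)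
      (act (z @ tau \<alpha>) ?r (tau \<beta>) @ ?\<Theta>w @ inv_arcs G.K ?\<Theta>w) (z @ tau \<alpha> @ tau w @ tau \<beta>)"
    using G.htpy_append_right[OF G.interchange[OF \<Theta> r]] G.path_inv[OF \<Theta>w] by simp
  also have "G.htpy (z @ tau \<alpha> @ tau u @ tau \<beta>)
      (act (z @ tau \<alpha>) ?r (tau \<beta>) @ ?\<Theta>w @ inv_arcs G.K ?\<Theta>w)
      (act (z @ tau \<alpha>) ?r (tau \<beta>)) (z @ tau \<alpha> @ tau w @ tau \<beta>)"
    using G.htpy_append_left[OF zr G.htpy_inv_right[OF \<Theta>w]] by simp
  finally have "G.htpy (z @ tau (\<alpha> @ u @ \<beta>)) (act (z @ tau \<alpha>) ?r (tau \<beta>)) (Psi \<one> q \<one>)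
      (z @ tau (\<alpha> @ w @ \<beta>))"
    using words uw' by (simp add: tau_append G.htpy_sym)
  with q show ?thesis by blast
qed

section \<open>Lifting arbitrary paths\<close>

lemma uh_phi_L_class: "w \<in> lists B \<Longrightarrow> \<one> \<otimes> v (uh @ phi w) \<otimes> \<one> \<in> L_class"
  using val_L_class h_L_class by simp

lemma Psi_uh_path:
  assumes "path_betw PS.K (uh @ phi u) q (uh @ phi w)" "u \<in> lists B" "w \<in> lists B"
  shows "path_betw G.K (z @ tau u) (Psi \<one> q \<one>) (z @ tau w)"
  using psi_path[OF assms(1) one_closed one_closed uh_phi_L_class[OF assms(2)]]
    psi_uh_phi[of \<one>] assms h_L_class by simp

text \<open>A naturality square over \<open>p\<close>: up to homotopy, \<open>full\<close>
  conjugates \<open>p\<close> to the image of a derivation \<open>q\<close> over \<open>P\<close>.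
  Such squares can be pasted and inverted, so single edges suffice.\<close>

definition lifts where
  "lifts u p w \<longleftrightarrow> (\<exists>q. path_betw PS.K (uh @ phi u) q (uh @ phi w) \<and>
    G.htpy u (p @ full w) (full u @ Psi \<one> q \<one>) (z @ tau w))"

lemma lifts_edge:
  assumes "\<alpha> \<in> lists B" "\<beta> \<in> lists B" "(u, w) \<in> rels PG"
  shows "lifts (\<alpha> @ u @ \<beta>) [Edge \<alpha> (u, w) True \<beta>] (\<alpha> @ w @ \<beta>)"
proof -
  have u: "\<alpha> @ u @ \<beta> \<in> lists B"
    using assms rels_PG_words by simp
  obtain q where q: "path_betw PS.K (uh @ phi (\<alpha> @ u @ \<beta>)) q (uh @ phi (\<alpha> @ w @ \<beta>))"
    "G.htpy (z @ tau (\<alpha> @ u @ \<beta>)) (act (z @ tau \<alpha>) (new_path u w) (tau \<beta>)) (Psi \<one> q \<one>)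
      (z @ tau (\<alpha> @ w @ \<beta>))"
    using old_path_in_context[OF assms] by blast
  have "G.htpy (\<alpha> @ u @ \<beta>) ([Edge \<alpha> (u, w) True \<beta>] @ full (\<alpha> @ w @ \<beta>))
      (full (\<alpha> @ u @ \<beta>) @ Psi \<one> q \<one>) (z @ tau (\<alpha> @ w @ \<beta>))"
    using G.htpy_trans[OF full_natural[OF assms] G.htpy_append_left[OF full_path[OF u] q(2)]] by simp
  with q(1) show ?thesis
    unfolding lifts_def by blast
qed

lemma lifts_append:
  assumes "lifts u p w" "lifts w p' y" "path_betw G.K u p w"
  shows "lifts u (p @ p') y"
proof -
  obtain q q' where q: "path_betw PS.K (uh @ phi u) q (uh @ phi w)"
      "G.htpy u (p @ full w) (full u @ Psi \<one> q \<one>) (z @ tau w)"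
    and q': "path_betw PS.K (uh @ phi w) q' (uh @ phi y)"
      "G.htpy w (p' @ full y) (full w @ Psi \<one> q' \<one>) (z @ tau y)"
    using assms(1,2) unfolding lifts_def by blast
  have "path_betw G.K w (full w @ Psi \<one> q' \<one>) (z @ tau y)"
    using G.htpy_path[OF q'(2)] by simp
  then obtain x where "path_betw G.K w (full w) x" "path_betw G.K x (Psi \<one> q' \<one>) (z @ tau y)"
    by (auto simp: G.path_append_iff)
  moreover have "x = z @ tau w"
    using calculation(1) full_path[of w] G.path_words[OF assms(3)] by (auto intro: G.path_end_unique)
  ultimately have "path_betw G.K (z @ tau w) (Psi \<one> q' \<one>) (z @ tau y)"
    by simp
  from G.htpy_trans[OF G.htpy_append_left[OF assms(3) q'(2)]] G.htpy_append_right[OF q(2) this]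
  have "G.htpy u ((p @ p') @ full y) (full u @ Psi \<one> (q @ q') \<one>) (z @ tau y)"
    by simp
  moreover have "path_betw PS.K (uh @ phi u) (q @ q') (uh @ phi y)"
    using q(1) q'(1) by (rule PS.path_append)
  ultimately show ?thesis
    unfolding lifts_def by blast
qed

lemma lifts_inv:
  assumes "lifts u p w" "path_betw G.K u p w"
  shows "lifts w (inv_arcs G.K p) u"
proof -
  obtain q where q: "path_betw PS.K (uh @ phi u) q (uh @ phi w)"
      "G.htpy u (p @ full w) (full u @ Psi \<one> q \<one>) (z @ tau w)"
    using assms(1) unfolding lifts_def by blast
  have words: "u \<in> lists B" "w \<in> lists B"
    using G.path_words[OF assms(2)] by simp_all
  let ?p = "inv_arcs G.K p" and ?q = "Psi \<one> q \<one>"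
  note q' = Psi_uh_path[OF q(1) words]
  have pu: "path_betw G.K w (?p @ full u) (z @ tau u)"
    by (rule G.path_append[OF G.path_inv[OF assms(2)] full_path[OF words(1)]])
  have "G.htpy w (?p @ full u) (?p @ full u @ ?q @ inv_arcs G.K ?q) (z @ tau u)"
    using G.htpy_append_left[OF pu G.htpy_sym[OF G.htpy_inv_right[OF q']]] by simp
  also have "G.htpy w (?p @ full u @ ?q @ inv_arcs G.K ?q) (?p @ p @ full w @ inv_arcs G.K ?q) (z @ tau u)"
    using G.htpy_context[OF G.htpy_sym[OF q(2)] G.path_inv[OF assms(2)] G.path_inv[OF q']] by simp
  also have "G.htpy w (?p @ p @ full w @ inv_arcs G.K ?q) (full w @ Psi \<one> (inv_arcs PS.K q) \<one>) (z @ tau u)"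
    using G.htpy_append_right[OF G.htpy_inv_left[OF assms(2)]
        G.path_append[OF full_path[OF words(2)] G.path_inv[OF q']]] by (simp add: Psi_inv)
  finally show ?thesis
    unfolding lifts_def using PS.path_inv[OF q(1)] by auto
qed

lemma lifts_path:
  assumes "path_betw G.K u p w"
  shows "lifts u p w"
  using assms
proof (induction p arbitrary: u)
  case Nil
  then have w: "u = w" "w \<in> lists B"
    by auto
  have "path_betw PS.K (uh @ phi w) [] (uh @ phi w)"
    using w by simp
  moreover have "G.htpy w ([] @ full w) (full w @ Psi \<one> [] \<one>) (z @ tau w)"
    using G.htpy_refl[OF full_path[OF w(2)]] by simp
  ultimately show ?case
    unfolding lifts_def w(1) by blast
next
  case (Cons e p)
  obtain \<alpha> s t \<epsilon> \<beta> where e: "e = Edge \<alpha> (s, t) \<epsilon> \<beta>"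
    by (metis edge.exhaust surj_pair)
  have e': "\<alpha> \<in> lists B" "\<beta> \<in> lists B" "(s, t) \<in> rels PG"
    using Cons.prems e by simp_all
  have path: "path_betw G.K (\<alpha> @ s @ \<beta>) [Edge \<alpha> (s, t) True \<beta>] (\<alpha> @ t @ \<beta>)"
    using e' rels_PG_words by simp
  \<comment> \<open>Only positive edges were lifted directly; a negative one is the inverse of a
    positive one.\<close>
  have "lifts u [e] (edge_target e)"
  proof (cases \<epsilon>)
    case True
    then show ?thesis
      using lifts_edge[OF e'] Cons.prems e by simp
  next
    case False
    then show ?thesis
      using lifts_inv[OF lifts_edge[OF e'] path] Cons.prems e by simp
  qed
  moreover have "path_betw G.K u [e] (edge_target e)" "lifts (edge_target e) p w"
    using Cons G.arc_ends_in_words by simp_all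
  ultimately show ?case
    using lifts_append[of u "[e]" "edge_target e" p w] by simp
qed

text \<open>A closed path lifts to a closed path over \<open>P\<close>, which contracts because
  \<open>X\<close> is a base; \<open>psi_htpy\<close> carries the contraction to the image. So
  \<open>p @ full u\<close> is homotopic to \<open>full u\<close>, which cancels.\<close>

lemma homotopy_base_XG: "homotopy_base PG XG"
proof -
  have "homotopic G.K (u, p) (u, [])" if "path_betw (squier_complex PG) u p u" for u p
  proof -
    have p: "path_betw G.K u p u"
      using that by (simp add: G.path_squier_iff)
    then have u: "u \<in> lists B"
      using G.path_words by simp
    obtain q where q: "path_betw PS.K (uh @ phi u) q (uh @ phi u)"
      "G.htpy u (p @ full u) (full u @ Psi \<one> q \<one>) (z @ tau u)"
      using lifts_path[OF p] unfolding lifts_def by blast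
    have "G.htpy (z @ tau u) (Psi \<one> q \<one>) (Psi \<one> [] \<one>) (z @ tau u)"
      using psi_htpy[OF one_closed one_closed htpy_closed[OF q(1)] uh_phi_L_class[OF u]]
        psi_uh_phi[of \<one> u] u h_L_class by simp
    from G.htpy_trans[OF q(2) G.htpy_append_left[OF full_path[OF u] this]]
    have "G.htpy u (p @ full u) ([] @ full u) (z @ tau u)"
      by simp
    then have "G.htpy u p [] u"
      by (rule G.htpy_cancel_right) (use p u in simp_all)
    then show ?thesis
      by (simp add: G.htpy_def)
  qed
  then show ?thesis
    using XG_closed by (auto simp: homotopy_base_def closed_paths_def)
qed

lemma presented_monoid_PG: "presented_monoid PG \<cong> schutz_group S H"
proof (rule presented_monoid_isoI[where f = "\<lambda>w. \<sigma> `` {val w}"])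
  let ?M = "S\<lparr>carrier := Stab\<rparr>"
  have M: "schutz_group S H = quot_monoid ?M \<sigma>"
    by (simp add: schutz_group_def)
  show "\<sigma> `` {val w} \<in> carrier (schutz_group S H)" if "w \<in> lists (gens PG)" for w
    using that val_Stab by (simp add: M quotientI)
  show "\<exists>w\<in>lists (gens PG). \<sigma> `` {val w} = g" if "g \<in> carrier (schutz_group S H)" for g
  proof -
    obtain s where s: "s \<in> Stab" "g = \<sigma> `` {s}"
      using \<open>g \<in> carrier (schutz_group S H)\<close> by (auto simp: M elim: quotientE)
    note word = word[OF Stab_carrier[OF s(1)]]
    \<comment> \<open>The labels read off a word for \<open>s\<close> behind \<open>h\<close> act on
      \<open>h\<close> as \<open>s\<close> does, since both end corrections are
      \<open>\<one>\<close>.\<close>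
    let ?w = "psi h (word s) \<one>"
    note hs = L_class_Stab[OF h_L_class s(1)]
    have w: "?w \<in> lists B"
      using word hs Stab_carrier[OF s(1)] by (intro psi_words) simp_all
    have "h \<otimes> rep h s \<otimes> val ?w = h \<otimes> s \<otimes> rep (h \<otimes> s) \<one>"
      using psi_value[of "word s" h \<one>] word hs Stab_carrier[OF s(1)] by simp
    moreover have "rep h s = \<one>" "rep (h \<otimes> s) \<one> = \<one>"
      using hs Stab_carrier[OF s(1)] by (auto intro!: rep_eq_one green_H_refl)
    ultimately have "h \<otimes> val ?w = h \<otimes> s"
      using w Stab_carrier[OF s(1)] by simp
    then have "(val ?w, s) \<in> \<sigma>"
      using schutz_cong_iff[OF h_L_class val_Stab[OF w] s(1)] by simp
    then show ?thesis
      using w s(2) equiv_class_eq[OF equiv_schutz_cong] by auto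
  qed
  show "\<sigma> `` {val (u @ w)} = \<sigma> `` {val u} \<otimes>\<^bsub>schutz_group S H\<^esub> \<sigma> `` {val w}"
    if "u \<in> lists (gens PG)" "w \<in> lists (gens PG)" for u w
    unfolding M
    using quot_monoid_mult[of ?M \<sigma> "val u" "val w"] that equiv_schutz_cong schutz_cong_mult val_Stab
    by (simp add: val_append)
  show "\<sigma> `` {val u} = \<sigma> `` {val w} \<longleftrightarrow> (u, w) \<in> cong_gen (free_monoid (gens PG)) (rels PG)"
    if "u \<in> lists (gens PG)" "w \<in> lists (gens PG)" for u w
  proof -
    have uw: "u \<in> lists B" "w \<in> lists B"
      using that by simp_all
    have "(u, w) \<in> cong_gen (free_monoid (gens PG)) (rels PG)" if \<sigma>: "(val u, val w) \<in> \<sigma>"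
    proof -
      obtain q where q: "path_betw PS.K (uh @ phi u) q (uh @ phi w)"
        using val_eq_imp_path[OF uw \<sigma>] by blast
      \<comment> \<open>Completeness of the relations: equal action on \<open>h\<close> gives a
        derivation over \<open>P\<close>, whose image joins the two words through
        \<open>full\<close>.\<close>
      have "path_betw G.K u (full u @ Psi \<one> q \<one> @ inv_arcs G.K (full w)) w"
        using G.path_append[OF full_path[OF uw(1)] G.path_append[OF Psi_uh_path[OF q uw]
            G.path_inv[OF full_path[OF uw(2)]]]] .
      then show ?thesis
        by (rule G.path_imp_cong_gen)
    qed
    moreover have "\<sigma> `` {val u} = \<sigma> `` {val w} \<longleftrightarrow> (val u, val w) \<in> \<sigma>"
      using eq_equiv_class_iff[OF equiv_schutz_cong val_Stab[OF uw(1)] val_Stab[OF uw(2)]] .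
    ultimately show ?thesis
      using cong_gen_val[of u w] by auto
  qed
qed

end

theorem corollary1:
  fixes S :: "('a, 'm) monoid_scheme"
  assumes "monoid S"
    and "finite {I. left_ideal S I}"
    and "finite {I. right_ideal S I}"
    and "monoid_FDT S"
  shows "\<forall>H \<in> carrier S // green_H S. monoid_FDT (schutz_group S H)"
proof
  fix H assume H: "H \<in> carrier S // green_H S"
  obtain P :: "nat presentation" and X where P: "finite_presentation P" "presented_monoid P \<cong> S"
    and X: "finite X" "homotopy_base P X"
    using assms(4) by (auto simp: monoid_FDT_def presentation_FDT_def)
  obtain v where v: "\<And>w. w \<in> lists (gens P) \<Longrightarrow> v w \<in> carrier S"
    "\<And>s. s \<in> carrier S \<Longrightarrow> \<exists>w\<in>lists (gens P). v w = s"
    "v [] = \<one>\<^bsub>S\<^esub>"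
    "\<And>u w. u \<in> lists (gens P) \<Longrightarrow> w \<in> lists (gens P) \<Longrightarrow> v (u @ w) = v u \<otimes>\<^bsub>S\<^esub> v w"
    "\<And>u w. u \<in> lists (gens P) \<Longrightarrow> w \<in> lists (gens P) \<Longrightarrow>
      v u = v w \<longleftrightarrow> (u, w) \<in> cong_gen (free_monoid (gens P)) (rels P)"
    using presented_monoid_isoE[OF P(2) assms(1)] by blast
  interpret h_class S H
    using assms(1) H by (simp add: h_class_def h_class_axioms_def)
  let ?L = "\<Union>a\<in>gens P. {lab x (v [a]) y | x y. x \<in> carrier S \<and> y \<in> carrier S \<and>
      x \<otimes>\<^bsub>S\<^esub> v [a] \<otimes>\<^bsub>S\<^esub> y \<in> L_class}"
  have "finite {lab x (v [a]) y | x y. x \<in> carrier S \<and> y \<in> carrier S \<and>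
      x \<otimes>\<^bsub>S\<^esub> v [a] \<otimes>\<^bsub>S\<^esub> y \<in> L_class}" if "a \<in> gens P" for a
    by (rule finite_contexts[OF assms(2,3)]) (use that v(1) lab_cong in auto)
  then have "finite ?L"
    using P(1) by (auto simp: finite_presentation_def)
  \<comment> \<open>Being finitely many, the labels can be encoded as natural numbers, the letters
    that \<open>monoid_FDT\<close> asks for.\<close>
  from finite_imp_inj_to_nat_seg[OF this] obtain enc :: "'a \<Rightarrow> nat" where enc: "inj_on enc ?L"
    by blast
  have P': "is_presentation P" "finite (gens P)" "finite (rels P)" "X \<subseteq> closed_paths (squier_complex P)"
    using P(1) X(2) by (simp_all add: finite_presentation_def homotopy_base_def)
  interpret schutz_rewriting S H P X v enc
    by unfold_locales (fact assms P' X enc v(3) | rule v; assumption)+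
  have "presentation_FDT PG"
    using finite_XG homotopy_base_XG by (auto simp: presentation_FDT_def)
  then show "monoid_FDT (schutz_group S H)"
    using finite_presentation_PG presented_monoid_PG by (auto simp: monoid_FDT_def)
qed

end
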